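(* For any two non-zero natural numbers $k$ and $t$: $k$ divides $t$ if and only if $\{\omega\cdot k,\ \omega^\star\cdot k\}\leq_c\{\omega\cdot t,\ \omega^\star\cdot t\}$.
   Context: All structures are in computable languages with domains contained in $\omega$; a class of structures is identified with the class of all isomorphic copies (with domain $\subseteq\omega$) of its members. An enumeration operator $\Gamma$ is a c.e. set of pairs $(\alpha,\varphi)$ where $\alpha$ is a finite set of basic (atomic or negated atomic) sentences of the input language with constants from $\omega$ and $\varphi$ is a basic sentence of the output language with constants from $\omega$; for a structure $\mathcal{S}$ with atomic diagram $D(\mathcal{S})$, $\Gamma(\mathcal{S})=\{\varphi : (\alpha,\varphi)\in\Gamma \text{ for some } \alpha\subseteq D(\mathcal{S})\}$. A computable embedding of a class $\mathcal{K}_0$ into a class $\mathcal{K}_1$ is an enumeration operator $\Gamma$ such that for every $\mathcal{A}\in\mathcal{K}_0$, $\Gamma(\mathcal{A})$ is the atomic diagram of a structure in $\mathcal{K}_1$, and for all $\mathcal{A},\mathcal{B}\in\mathcal{K}_0$, $\mathcal{A}\cong\mathcal{B}$ iff $\Gamma(\mathcal{A})\cong\Gamma(\mathcal{B})$. For non-isomorphic $\mathcal{A},\mathcal{B}$, $\{\mathcal{A},\mathcal{B}\}\leq_c\{\mathcal{C},\mathcal{D}\}$ means there is a computable embedding $\Gamma$ of the class of all copies of $\mathcal{A}$ and $\mathcal{B}$ into the class of all copies of $\mathcal{C}$ and $\mathcal{D}$ with $\Gamma(\mathcal{A})\cong\mathcal{C}$ and $\Gamma(\mathcal{B})\cong\mathcal{D}$.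 Here $\omega$ is the order type of the natural numbers, $\omega^\star$ its reverse, $\omega\cdot k$ is the order type of $k$ copies of $\omega$ placed one after another, and $\omega^\star\cdot k$ that of $k$ copies of $\omega^\star$ placed one after another. *)

theory Defs
  imports Main "HOL-Library.Nat_Bijection"
begin

text \<open>
  Programs for the partial recursive functions. Arities are not recorded: on a list of
  arguments to which the rules below do not apply a program is undefined. For every fixed
  length of the argument list the functions computed are exactly the partial recursive
  functions of that arity.
\<close>

datatype recf =
    Zero
  | Succ
  | Proj nat
  | Comp recf "recf list"
  | PrimRec recf recf
  | Minim recf

text \<open>
  In \<open>PrimRec f g\<close> the recursion argument comes first, and \<open>g\<close> is applied to the predecessor,
  the previous value and the parameters, in this order. \<open>Minim f\<close> searches for the least zero
  of \<open>f\<close> in its first argument; all earlier values must be defined.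
\<close>

inductive computes :: "recf \<Rightarrow> nat list \<Rightarrow> nat \<Rightarrow> bool" where
  Zero: "computes Zero xs 0"
| Succ: "computes Succ [x] (Suc x)"
| Proj: "i < length xs \<Longrightarrow> computes (Proj i) xs (xs ! i)"
| Comp: "\<lbrakk>length ys = length gs; \<forall>i<length gs. computes (gs ! i) xs (ys ! i); computes f ys v\<rbrakk>
    \<Longrightarrow> computes (Comp f gs) xs v"
| PrimRec_0: "computes f xs v \<Longrightarrow> computes (PrimRec f g) (0 # xs) v"
| PrimRec_Suc: "\<lbrakk>computes (PrimRec f g) (n # xs) u; computes g (n # u # xs) v\<rbrakk>
    \<Longrightarrow> computes (PrimRec f g) (Suc n # xs) v"
| Minim: "\<lbrakk>computes f (n # xs) 0; \<forall>i<n. \<exists>v>0. computes f (i # xs) v\<rbrakk>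
    \<Longrightarrow> computes (Minim f) xs n"

definition ce_set :: "nat set \<Rightarrow> bool" where
  "ce_set A \<longleftrightarrow> (\<exists>f. A = {n. \<exists>v. computes f [n] v})"

text \<open>
  Structures in the language with one binary relation symbol, for the strict order. Only
  the restriction of \<open>lt\<close> to the domain is relevant. The structures of computable structure
  theory have type \<open>nat ordstruct\<close>, with an arbitrary set of natural numbers as domain; other
  element types only serve to name isomorphism types.
\<close>

record 'a ordstruct =
  dom :: "'a set"
  lt :: "'a \<Rightarrow> 'a \<Rightarrow> bool"

definition isomorphic :: "'a ordstruct \<Rightarrow> 'b ordstruct \<Rightarrow> bool" (infix "\<cong>" 50) where
  "A \<cong> B \<longleftrightarrow> (\<exists>h. bij_betw h (dom A) (dom B) \<and>
     (\<forall>x\<in>dom A. \<forall>y\<in>dom A. lt A x y \<longleftrightarrow> lt B (h x) (h y)))"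

definition copies :: "'a ordstruct \<Rightarrow> nat ordstruct set" where
  "copies A = {S. A \<cong> S}"

definition omega :: "nat ordstruct" where
  "omega = \<lparr>dom = UNIV, lt = (\<lambda>x y. x < y)\<rparr>"

definition omega_star :: "nat ordstruct" where
  "omega_star = \<lparr>dom = UNIV, lt = (\<lambda>x y. y < x)\<rparr>"

text \<open>\<open>A \<cdot> k\<close> is \<open>k\<close> copies of \<open>A\<close> placed one after another; \<open>(i, x)\<close> is the element \<open>x\<close> of
  the \<open>i\<close>-th copy.\<close>

definition times :: "'a ordstruct \<Rightarrow> nat \<Rightarrow> (nat \<times> 'a) ordstruct" (infixl "\<cdot>" 70) where
  "A \<cdot> k = \<lparr>dom = {..<k} \<times> dom A,
            lt = (\<lambda>(i, x) (j, y). i < j \<or> (i = j \<and> lt A x y))\<rparr>"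

datatype basic =
    Eq nat nat
  | Neq nat nat
  | Less nat nat
  | NotLess nat nat

primrec satisfies :: "nat ordstruct \<Rightarrow> basic \<Rightarrow> bool" where
  "satisfies S (Eq x y) \<longleftrightarrow> x = y"
| "satisfies S (Neq x y) \<longleftrightarrow> x \<noteq> y"
| "satisfies S (Less x y) \<longleftrightarrow> lt S x y"
| "satisfies S (NotLess x y) \<longleftrightarrow> \<not> lt S x y"

primrec constants :: "basic \<Rightarrow> nat set" where
  "constants (Eq x y) = {x, y}"
| "constants (Neq x y) = {x, y}"
| "constants (Less x y) = {x, y}"
| "constants (NotLess x y) = {x, y}"

definition diagram :: "nat ordstruct \<Rightarrow> basic set" where
  "diagram S = {\<phi>. constants \<phi> \<subseteq> dom S \<and> satisfies S \<phi>}"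

primrec code_basic :: "basic \<Rightarrow> nat" where
  "code_basic (Eq x y) = prod_encode (0, prod_encode (x, y))"
| "code_basic (Neq x y) = prod_encode (1, prod_encode (x, y))"
| "code_basic (Less x y) = prod_encode (2, prod_encode (x, y))"
| "code_basic (NotLess x y) = prod_encode (3, prod_encode (x, y))"

text \<open>A finite set of basic sentences is coded by the canonical index of the set of codes of
  its elements.\<close>

definition code_pair :: "basic set \<times> basic \<Rightarrow> nat" where
  "code_pair = (\<lambda>(\<alpha>, \<phi>). prod_encode (set_encode (code_basic ` \<alpha>), code_basic \<phi>))"

definition enumeration_operator :: "(basic set \<times> basic) set \<Rightarrow> bool" where
  "enumeration_operator \<Gamma> \<longleftrightarrow> (\<forall>(\<alpha>, \<phi>)\<in>\<Gamma>. finite \<alpha>) \<and> ce_set (code_pair ` \<Gamma>)"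

definition apply_op :: "(basic set \<times> basic) set \<Rightarrow> nat ordstruct \<Rightarrow> basic set" where
  "apply_op \<Gamma> S = {\<phi>. \<exists>\<alpha>. (\<alpha>, \<phi>) \<in> \<Gamma> \<and> \<alpha> \<subseteq> diagram S}"

text \<open>A diagram determines the domain of a structure and the relation on the domain, so the
  structures \<open>S\<close> and \<open>T\<close> below are unique up to the irrelevant part of \<open>lt\<close>.\<close>

definition computable_embedding ::
  "(basic set \<times> basic) set \<Rightarrow> nat ordstruct set \<Rightarrow> nat ordstruct set \<Rightarrow> bool" where
  "computable_embedding \<Gamma> K0 K1 \<longleftrightarrow>
     enumeration_operator \<Gamma> \<and>
     (\<forall>A\<in>K0. \<exists>S\<in>K1. apply_op \<Gamma> A = diagram S) \<and>
     (\<forall>A\<in>K0. \<forall>B\<in>K0. \<forall>S T. apply_op \<Gamma> A = diagram S \<longrightarrow> apply_op \<Gamma> B = diagram T \<longrightarrow>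
        (A \<cong> B \<longleftrightarrow> S \<cong> T))"

text \<open>\<open>pair_le_c A B C D\<close> is the reducibility of the pair \<open>A, B\<close> to the pair \<open>C, D\<close>, where
  \<open>A\<close> is sent to \<open>C\<close> and \<open>B\<close> to \<open>D\<close>; it is meant for non-isomorphic \<open>A\<close> and \<open>B\<close>.\<close>

definition pair_le_c ::
  "'a ordstruct \<Rightarrow> 'a ordstruct \<Rightarrow> 'b ordstruct \<Rightarrow> 'b ordstruct \<Rightarrow> bool" where
  "pair_le_c A B C D \<longleftrightarrow>
     (\<exists>\<Gamma>. computable_embedding \<Gamma> (copies A \<union> copies B) (copies C \<union> copies D) \<and>
        (\<forall>S\<in>copies A. \<exists>T\<in>copies C. apply_op \<Gamma> S = diagram T) \<and>
        (\<forall>S\<in>copies B. \<exists>T\<in>copies D. apply_op \<Gamma> S = diagram T))"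

end

theory Submission
  imports Defs Complex_Main "HOL-Library.Ramsey"
begin

text \<open>
  If \<open>t = k * m\<close>, sending a structure to \<open>m\<close> consecutive copies of itself is a computable embedding.

  Conversely, an enumeration operator that maps copies of \<open>\<omega> \<cdot> k\<close> to copies of \<open>\<omega> \<cdot> t\<close> and copies of
  \<open>\<omega>\<^sup>\<star> \<cdot> k\<close> to copies of \<open>\<omega>\<^sup>\<star> \<cdot> t\<close> decides the order between output elements enumerated from
  a finite input order \<open>F\<close> by \<open>F\<close> alone, because two extensions of \<open>F\<close> are both compatible with \<open>F\<close>
  followed by a fresh copy of \<open>\<omega> \<cdot> k\<close>. Cut a copy of \<open>\<omega> \<cdot> k\<close> into finite chunks
  such that the \<open>n\<close>-th chunk enumerates one element of each of the \<open>t\<close> blocks of the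
  output. By Ramsey's theorem one may assume that for \<open>n < m\<close> the order between the elements of
  blocks \<open>j\<close> and \<open>j'\<close> obtained from the \<open>n\<close>-th and the \<open>m\<close>-th chunk depends only on how the \<open>k\<close>
  pieces of these chunks are placed relative to each other. This makes the pairs of a block and an
  increasing \<open>k\<close>-tuple of positions totally preordered, and comparing \<open>\<omega> \<cdot> k\<close> with \<open>\<omega>\<^sup>\<star> \<cdot> k\<close> shows,
  as in Arrow's theorem, that for each block this preorder is dictated by a single coordinate
  \<open>i < k\<close>. Placing all chunks one after another in \<open>k\<close> parts, each block with dictator \<open>i\<close> yields
  \<open>k\<close> copies of \<open>\<omega>\<close> in the output, so at most \<open>t / k\<close> blocks have dictator \<open>i\<close>. As each of the \<open>t\<close>
  blocks has one of \<open>k\<close> dictators, equality holds and \<open>k\<close> divides \<open>t\<close>.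
\<close>

section \<open>Total computable functions\<close>

lemma computes_functional: "computes f xs v \<Longrightarrow> computes f xs w \<Longrightarrow> v = w"
proof (induction arbitrary: w rule: computes.induct)
  case (Comp ys gs xs f v)
  from Comp.prems obtain zs where zs: "length zs = length gs"
    "\<forall>i<length gs. computes (gs ! i) xs (zs ! i)" "computes f zs w"
    by (cases rule: computes.cases) auto
  have "ys = zs"
    using Comp.hyps Comp.IH zs by (intro nth_equalityI) auto
  then show ?case
    using Comp.IH zs by blast
next
  case (PrimRec_Suc f g n xs u v)
  from PrimRec_Suc.prems obtain u' where "computes (PrimRec f g) (n # xs) u'"
    "computes g (n # u' # xs) w"
    by (cases rule: computes.cases) auto
  then show ?case
    using PrimRec_Suc.IH by blast
next
  case (Minim f n xs)
  from Minim.prems have w: "computes f (w # xs) 0" "\<forall>i<w. \<exists>v>0. computes f (i # xs) v"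
    by (cases rule: computes.cases; auto)+
  have "\<not> w < n"
    using w(1) Minim.IH(2) by fastforce
  moreover have "\<not> n < w"
    using w(2) Minim.IH(1) by fastforce
  ultimately show ?case by simp
next
  case (PrimRec_0 f xs v g)
  from PrimRec_0.prems have "computes f xs w"
    by (cases rule: computes.cases) auto
  then show ?case
    by (rule PrimRec_0.IH)
qed (erule computes.cases; auto; fail)+

text \<open>Programs carry no arity, so the length is fixed: a program need only be right on lists
  of \<open>n\<close> arguments.\<close>

definition total_computable :: "nat \<Rightarrow> (nat list \<Rightarrow> nat) \<Rightarrow> bool" where
  "total_computable n F \<longleftrightarrow> (\<exists>r. \<forall>xs. length xs = n \<longrightarrow> computes r xs (F xs))"

lemma total_computable_proj: "i < n \<Longrightarrow> total_computable n (\<lambda>xs. xs ! i)"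
  unfolding total_computable_def by (auto intro: computes.Proj)

lemma total_computable_comp:
  assumes "total_computable (length Gs) F"
    and "\<And>G. G \<in> set Gs \<Longrightarrow> total_computable n G"
  shows "total_computable n (\<lambda>xs. F (map (\<lambda>G. G xs) Gs))"
proof -
  obtain r where r: "\<And>xs. length xs = length Gs \<Longrightarrow> computes r xs (F xs)"
    using assms(1) unfolding total_computable_def by blast
  have "\<forall>i<length Gs. \<exists>q. \<forall>xs. length xs = n \<longrightarrow> computes q xs ((Gs ! i) xs)"
    using assms(2) unfolding total_computable_def by simp
  then obtain q where q: "\<And>i xs. i < length Gs \<Longrightarrow> length xs = n \<Longrightarrow> computes (q i) xs ((Gs ! i) xs)"
    by metis
  have "computes (Comp r (map q [0..<length Gs])) xs (F (map (\<lambda>G. G xs) Gs))"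
    if "length xs = n" for xs
    using q that by (intro computes.Comp[where ys = "map (\<lambda>G. G xs) Gs"] r) auto
  then show ?thesis
    unfolding total_computable_def by blast
qed

lemma total_computable_comp1:
  assumes "total_computable 1 (\<lambda>xs. f (xs ! 0))" "total_computable n G"
  shows "total_computable n (\<lambda>xs. f (G xs))"
  using total_computable_comp[of "[G]" "\<lambda>xs. f (xs ! 0)" n] assms by simp

lemma total_computable_comp2:
  assumes "total_computable 2 (\<lambda>xs. f (xs ! 0) (xs ! 1))" "total_computable n G" "total_computable n H"
  shows "total_computable n (\<lambda>xs. f (G xs) (H xs))"
  using total_computable_comp[of "[G, H]" "\<lambda>xs. f (xs ! 0) (xs ! 1)" n] assms
  by (auto simp: numeral_2_eq_2)

lemma total_computable_Suc:
  assumes "total_computable n G"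
  shows "total_computable n (\<lambda>xs. Suc (G xs))"
proof -
  have "computes Succ xs (Suc (xs ! 0))" if "length xs = 1" for xs
    using that by (cases xs) (auto intro: computes.Succ)
  then have "total_computable 1 (\<lambda>xs. Suc (xs ! 0))"
    unfolding total_computable_def by blast
  then show ?thesis
    using assms by (rule total_computable_comp1)
qed

lemma total_computable_const: "total_computable n (\<lambda>_. c)"
proof (induction c)
  case 0
  then show ?case
    unfolding total_computable_def by (auto intro: computes.Zero)
next
  case (Suc c)
  then show ?case
    by (rule total_computable_Suc)
qed

lemmas total_computable_intros = total_computable_proj total_computable_const total_computable_Suc

lemma total_computable_primrec:
  assumes "total_computable n F" "total_computable (Suc (Suc n)) G"
    and zero: "\<And>ys. length ys = n \<Longrightarrow> R (0 # ys) = F ys"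
    and Suc: "\<And>x ys. length ys = n \<Longrightarrow> R (Suc x # ys) = G (x # R (x # ys) # ys)"
  shows "total_computable (Suc n) R"
proof -
  obtain f g where f: "\<And>xs. length xs = n \<Longrightarrow> computes f xs (F xs)"
    and g: "\<And>xs. length xs = Suc (Suc n) \<Longrightarrow> computes g xs (G xs)"
    using assms(1,2) unfolding total_computable_def by blast
  have rec: "computes (PrimRec f g) (x # ys) (R (x # ys))" if "length ys = n" for x ys
  proof (induction x)
    case 0
    then show ?case
      using f that zero by (auto intro: computes.PrimRec_0)
  next
    case (Suc x)
    have "computes g (x # R (x # ys) # ys) (R (Suc x # ys))"
      using g that assms(4) by simp
    with Suc show ?case
      by (rule computes.PrimRec_Suc)
  qed
  have "computes (PrimRec f g) xs (R xs)" if "length xs = Suc n" for xs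
    using that rec by (cases xs) auto
  then show ?thesis
    unfolding total_computable_def by blast
qed

lemma total_computable_add:
  assumes "total_computable n G" "total_computable n H"
  shows "total_computable n (\<lambda>xs. G xs + H xs)"
proof (rule total_computable_comp2[OF _ assms])
  have "total_computable (Suc 1) (\<lambda>xs. xs ! 0 + xs ! 1)"
    by (rule total_computable_primrec[where F = "\<lambda>xs. xs ! 0" and G = "\<lambda>xs. Suc (xs ! 1)"])
      (simp_all add: total_computable_intros)
  then show "total_computable 2 (\<lambda>xs. xs ! 0 + xs ! 1)"
    by (simp add: numeral_2_eq_2)
qed

lemma total_computable_mult:
  assumes "total_computable n G" "total_computable n H"
  shows "total_computable n (\<lambda>xs. G xs * H xs)"
proof (rule total_computable_comp2[OF _ assms])
  have "total_computable (Suc 1) (\<lambda>xs. xs ! 0 * xs ! 1)"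
    by (rule total_computable_primrec[where F = "\<lambda>xs. 0" and G = "\<lambda>xs. xs ! 2 + xs ! 1"])
      (simp_all add: total_computable_intros total_computable_add)
  then show "total_computable 2 (\<lambda>xs. xs ! 0 * xs ! 1)"
    by (simp add: numeral_2_eq_2)
qed

lemma total_computable_diff:
  assumes "total_computable n G" "total_computable n H"
  shows "total_computable n (\<lambda>xs. G xs - H xs)"
\<comment> \<open>The recursion argument comes first, so the arguments are swapped to make the
  subtrahend the recursion argument.\<close>
proof (rule total_computable_comp2[of "\<lambda>x y. y - x", OF _ assms(2,1)])
  have "total_computable (Suc 0) (\<lambda>xs. xs ! 0 - 1)"
    by (rule total_computable_primrec[where F = "\<lambda>xs. 0" and G = "\<lambda>xs. xs ! 0"])
      (simp_all add: total_computable_intros)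
  then have pred: "total_computable n (\<lambda>xs. G xs - 1)" if "total_computable n G" for n G
    using total_computable_comp1[of "\<lambda>x. x - 1", OF _ that] by simp
  have "total_computable (Suc 1) (\<lambda>xs. xs ! 1 - xs ! 0)"
    by (rule total_computable_primrec[where F = "\<lambda>xs. xs ! 0" and G = "\<lambda>xs. xs ! 1 - 1"])
      (simp_all add: total_computable_intros pred[simplified])
  then show "total_computable 2 (\<lambda>xs. xs ! 1 - xs ! 0)"
    by (simp add: numeral_2_eq_2)
qed

lemma total_computable_power2:
  assumes "total_computable n G"
  shows "total_computable n (\<lambda>xs. 2 ^ G xs)"
proof (rule total_computable_comp1[OF _ assms])
  have "total_computable (Suc 0) (\<lambda>xs. 2 ^ (xs ! 0))"
    by (rule total_computable_primrec[where F = "\<lambda>xs. 1" and G = "\<lambda>xs. 2 * xs ! 1"])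
      (simp_all add: total_computable_intros total_computable_mult)
  then show "total_computable 1 (\<lambda>xs. 2 ^ (xs ! 0))"
    by simp
qed

lemma total_computable_prod_encode:
  assumes "total_computable n G" "total_computable n H"
  shows "total_computable n (\<lambda>xs. prod_encode (G xs, H xs))"
proof -
  have "total_computable (Suc 0) (\<lambda>xs. triangle (xs ! 0))"
    by (rule total_computable_primrec[where F = "\<lambda>xs. 0" and G = "\<lambda>xs. xs ! 1 + Suc (xs ! 0)"])
      (simp_all add: total_computable_intros total_computable_add)
  then have "total_computable n (\<lambda>xs. triangle (G xs + H xs))"
    using total_computable_comp1[of triangle n "\<lambda>xs. G xs + H xs"] assms
    by (simp add: total_computable_add)
  then show ?thesis
    unfolding prod_encode_def using assms by (simp add: total_computable_add)
qed

text \<open>A bounded product serves as a bounded existential quantifier: over the natural numbers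
  it is zero exactly if one factor is.\<close>

lemma total_computable_bounded_prod:
  assumes "total_computable (Suc n) Z"
  shows "total_computable (Suc n) (\<lambda>xs. \<Prod>x\<le>hd xs. Z (x # tl xs))"
proof (rule total_computable_primrec)
  \<comment> \<open>Composition with projections puts \<open>0\<close>, and below the successor of
    the predecessor, in place of the bounded variable.\<close>
  have "total_computable n (\<lambda>xs. Z (map (\<lambda>G. G xs) ((\<lambda>_. 0) # map (\<lambda>i xs. xs ! i) [0..<n])))"
    using assms by (intro total_computable_comp) (auto intro: total_computable_intros)
  then show "total_computable n (\<lambda>xs. Z (0 # map (\<lambda>i. xs ! i) [0..<n]))"
    by (simp add: comp_def)
  have "total_computable (Suc (Suc n)) (\<lambda>xs. Z (map (\<lambda>G. G xs)
      ((\<lambda>xs. Suc (xs ! 0)) # map (\<lambda>i xs. xs ! Suc (Suc i)) [0..<n])))"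
    using assms by (intro total_computable_comp) (auto intro: total_computable_intros)
  then show "total_computable (Suc (Suc n))
      (\<lambda>xs. xs ! 1 * Z (Suc (xs ! 0) # map (\<lambda>i. xs ! Suc (Suc i)) [0..<n]))"
    by (intro total_computable_mult total_computable_proj) (simp_all add: comp_def)
qed (auto simp: map_nth)

lemma total_computable_prod_finite:
  assumes "finite I" "\<And>i. i \<in> I \<Longrightarrow> total_computable n (F i)"
  shows "total_computable n (\<lambda>xs. \<Prod>i\<in>I. F i xs)"
  using assms by (induction I) (auto intro: total_computable_const total_computable_mult)

text \<open>The program searched by \<open>Minim\<close> ignores its search variable: the search
  stops at \<open>0\<close> if \<open>Z [n]\<close> is zero and never stops otherwise.\<close>

lemma ce_set_zeros:
  assumes "total_computable 1 Z"
  shows "ce_set {n. Z [n] = 0}"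
proof -
  have "total_computable 2 (\<lambda>xs. Z (map (\<lambda>G. G xs) [\<lambda>xs. xs ! 1]))"
    using assms by (intro total_computable_comp) (auto intro: total_computable_intros)
  then obtain r where "\<And>xs. length xs = 2 \<Longrightarrow> computes r xs (Z [xs ! 1])"
    unfolding total_computable_def by auto
  then have r: "computes r [i, n] (Z [n])" for i n
    by (metis One_nat_def Suc_1 length_Cons list.size(3) nth_Cons_0 nth_Cons_Suc)
  have "(\<exists>v. computes (Minim r) [n] v) \<longleftrightarrow> Z [n] = 0" for n
  proof
    assume "\<exists>v. computes (Minim r) [n] v"
    then obtain v where "computes r [v, n] 0"
      by (auto elim: computes.cases)
    then show "Z [n] = 0"
      using computes_functional r by blast
  next
    assume "Z [n] = 0"
    then have "computes (Minim r) [n] 0"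
      using r[of 0 n] by (auto intro: computes.Minim)
    then show "\<exists>v. computes (Minim r) [n] v" ..
  qed
  then show ?thesis
    unfolding ce_set_def by (intro exI[of _ "Minim r"]) auto
qed

text \<open>Since \<open>x\<close> and \<open>y\<close> are at most the code \<open>c i x y\<close>,
  a search up to \<open>n\<close> decides whether \<open>n\<close> is in the range.\<close>

lemma ce_set_bounded_range:
  assumes "finite I"
    and comp: "\<And>i. i \<in> I \<Longrightarrow> total_computable 2 (\<lambda>xs. c i (xs ! 0) (xs ! 1))"
    and bound: "\<And>i x y. i \<in> I \<Longrightarrow> x \<le> c i x y" "\<And>i x y. i \<in> I \<Longrightarrow> y \<le> c i x y"
  shows "ce_set {c i x y | i x y. i \<in> I}"
proof -
  \<comment> \<open>The two truncated differences add up to a distance, so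
    \<open>W [x, y, n]\<close> vanishes exactly if \<open>n = c i x y\<close> for some
    \<open>i \<in> I\<close>.\<close>
  define W where "W = (\<lambda>xs. \<Prod>i\<in>I. (xs ! 2 - c i (xs ! 0) (xs ! 1)) + (c i (xs ! 0) (xs ! 1) - xs ! 2))"
  have c3: "total_computable 3 (\<lambda>xs. c i (xs ! 0) (xs ! 1))" if "i \<in> I" for i
    using comp[OF that] by (rule total_computable_comp2) (intro total_computable_proj; simp)+
  have "total_computable (Suc 2) W"
    unfolding W_def by (rule total_computable_prod_finite[OF assms(1)]) 
      (simp_all add: total_computable_add total_computable_diff total_computable_proj
        c3[unfolded numeral_3_eq_3, simplified] numeral_3_eq_3 numeral_2_eq_2)
  then have "total_computable (Suc 2) (\<lambda>xs. \<Prod>x\<le>hd xs. W (x # tl xs))"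
    by (rule total_computable_bounded_prod)
  \<comment> \<open>The arguments are now \<open>[y, n]\<close>, and \<open>n\<close> itself bounds
    \<open>x\<close>; the same is done for \<open>y\<close> below.\<close>
  then have "total_computable 2 (\<lambda>xs. (\<lambda>xs. \<Prod>x\<le>hd xs. W (x # tl xs))
      (map (\<lambda>G. G xs) [\<lambda>xs. xs ! 1, \<lambda>xs. xs ! 0, \<lambda>xs. xs ! 1]))"
    by (intro total_computable_comp) (auto intro: total_computable_intros simp: numeral_3_eq_3)
  then have "total_computable (Suc 1) (\<lambda>xs. \<Prod>x\<le>xs ! 1. W [x, xs ! 0, xs ! 1])"
    by (simp add: numeral_2_eq_2)
  then have "total_computable (Suc 1) (\<lambda>xs. \<Prod>y\<le>hd xs. \<Prod>x\<le>(y # tl xs) ! 1. W [x, (y # tl xs) ! 0, (y # tl xs) ! 1])"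
    by (rule total_computable_bounded_prod)
  then have "total_computable 1 (\<lambda>xs. (\<lambda>xs. \<Prod>y\<le>hd xs. \<Prod>x\<le>(y # tl xs) ! 1. W [x, (y # tl xs) ! 0, (y # tl xs) ! 1])
      (map (\<lambda>G. G xs) [\<lambda>xs. xs ! 0, \<lambda>xs. xs ! 0]))"
    by (intro total_computable_comp) (auto intro: total_computable_intros)
  then have "ce_set {n. (\<lambda>xs. \<Prod>y\<le>xs ! 0. \<Prod>x\<le>xs ! 0. W [x, y, xs ! 0]) [n] = 0}"
    by (intro ce_set_zeros) simp
  moreover have "{n. (\<lambda>xs. \<Prod>y\<le>xs ! 0. \<Prod>x\<le>xs ! 0. W [x, y, xs ! 0]) [n] = 0} = {c i x y | i x y. i \<in> I}"
    using assms(1) bound by (fastforce simp: W_def)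
  ultimately show ?thesis by simp
qed

section \<open>Isomorphic copies\<close>

lemma isomorphic_sym: "A \<cong> B \<Longrightarrow> B \<cong> A"
proof -
  assume "A \<cong> B"
  then obtain h where h: "bij_betw h (dom A) (dom B)"
    "\<forall>x\<in>dom A. \<forall>y\<in>dom A. lt A x y \<longleftrightarrow> lt B (h x) (h y)"
    unfolding isomorphic_def by blast
  let ?g = "inv_into (dom A) h"
  have "bij_betw ?g (dom B) (dom A)"
    using h(1) by (rule bij_betw_inv_into)
  moreover have "lt B x y \<longleftrightarrow> lt A (?g x) (?g y)" if "x \<in> dom B" "y \<in> dom B" for x y
    using h that bij_betw_inv_into_right[OF h(1)] bij_betwE[OF bij_betw_inv_into[OF h(1)]] by metis
  ultimately show ?thesis
    unfolding isomorphic_def by blast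
qed

lemma isomorphic_trans: "A \<cong> B \<Longrightarrow> B \<cong> C \<Longrightarrow> A \<cong> C"
proof -
  assume "A \<cong> B" "B \<cong> C"
  then obtain g h where g: "bij_betw g (dom A) (dom B)"
    "\<forall>x\<in>dom A. \<forall>y\<in>dom A. lt A x y \<longleftrightarrow> lt B (g x) (g y)"
    and h: "bij_betw h (dom B) (dom C)"
    "\<forall>x\<in>dom B. \<forall>y\<in>dom B. lt B x y \<longleftrightarrow> lt C (h x) (h y)"
    unfolding isomorphic_def by blast
  have "bij_betw (h \<circ> g) (dom A) (dom C)"
    using g(1) h(1) by (rule bij_betw_trans)
  moreover have "\<forall>x\<in>dom A. \<forall>y\<in>dom A. lt A x y \<longleftrightarrow> lt C ((h \<circ> g) x) ((h \<circ> g) y)"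
    using g(2) h(2) bij_betwE[OF g(1)] by simp
  ultimately show ?thesis
    unfolding isomorphic_def by blast
qed

lemma copies_isomorphic: "S \<in> copies A \<Longrightarrow> T \<in> copies A \<Longrightarrow> S \<cong> T"
  unfolding copies_def using isomorphic_sym isomorphic_trans by blast

lemma copies_closed: "S \<in> copies A \<Longrightarrow> S \<cong> T \<Longrightarrow> T \<in> copies A"
  unfolding copies_def using isomorphic_trans by blast

text \<open>The domain is read off from the sentences \<open>Eq x x\<close> and the order from the
  sentences \<open>Less x y\<close>, so the identity is an isomorphism.\<close>

lemma isomorphic_if_diagram_eq:
  assumes "diagram S = diagram T"
  shows "S \<cong> T"
proof -
  have Eq: "x \<in> dom S \<longleftrightarrow> Eq x x \<in> diagram S" for x and S :: "nat ordstruct"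
    unfolding diagram_def by simp
  have Less: "x \<in> dom S \<Longrightarrow> y \<in> dom S \<Longrightarrow> lt S x y \<longleftrightarrow> Less x y \<in> diagram S"
    for x y and S :: "nat ordstruct"
    unfolding diagram_def by simp
  have "dom S = dom T"
    using Eq assms by blast
  moreover from this have "\<forall>x\<in>dom S. \<forall>y\<in>dom S. lt S x y \<longleftrightarrow> lt T x y"
    using Less assms by metis
  ultimately show ?thesis
    unfolding isomorphic_def by (intro exI[of _ id]) auto
qed

text \<open>The element \<open>(0, 0)\<close> is least in \<open>omega \<cdot> k\<close>, while in
  \<open>omega_star \<cdot> k\<close> every \<open>(p, q)\<close> has \<open>(p, Suc q)\<close>
  below it.\<close>

lemma not_isomorphic_omega_omega_star:
  assumes "k \<noteq> 0"
  shows "\<not> omega \<cdot> k \<cong> omega_star \<cdot> k"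
proof
  assume "omega \<cdot> k \<cong> omega_star \<cdot> k"
  then obtain h where h: "bij_betw h ({..<k} \<times> UNIV) ({..<k} \<times> UNIV)"
    and lt: "\<And>x y. x \<in> {..<k} \<times> UNIV \<Longrightarrow> y \<in> {..<k} \<times> UNIV \<Longrightarrow>
      lt (omega \<cdot> k) x y \<longleftrightarrow> lt (omega_star \<cdot> k) (h x) (h y)"
    unfolding isomorphic_def times_def omega_def omega_star_def by (auto 0 3)
  have 0: "(0, 0) \<in> {..<k} \<times> (UNIV :: nat set)"
    using assms by simp
  obtain p q where pq: "h (0, 0) = (p, q)" "p < k"
    using bij_betwE[OF h] 0 by (metis SigmaE lessThan_iff)
  then have "(p, Suc q) \<in> h ` ({..<k} \<times> UNIV)"
    using h by (auto simp: bij_betw_def)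
  then obtain x where x: "x \<in> {..<k} \<times> UNIV" "h x = (p, Suc q)"
    by (metis imageE)
  have "lt (omega_star \<cdot> k) (h x) (h (0, 0))"
    using pq x by (simp add: times_def omega_star_def)
  then have "lt (omega \<cdot> k) x (0, 0)"
    using lt[OF x(1) 0] by simp
  then show False
    by (cases x) (simp add: times_def omega_def)
qed

section \<open>Repeating a structure\<close>

text \<open>The number \<open>u\<close> stands for the element \<open>u div m\<close> of
  \<open>S\<close> in the copy with index \<open>u mod m\<close>.\<close>

definition repeat :: "nat \<Rightarrow> nat ordstruct \<Rightarrow> nat ordstruct" where
  "repeat m S = \<lparr>dom = {u. u div m \<in> dom S},
     lt = (\<lambda>u v. u mod m < v mod m \<or> (u mod m = v mod m \<and> lt S (u div m) (v div m)))\<rparr>"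

lemma repeat_copies:
  assumes "m \<noteq> 0" and "S \<in> copies (A \<cdot> k)"
  shows "repeat m S \<in> copies (A \<cdot> (k * m))"
proof -
  obtain h where bij: "bij_betw h ({..<k} \<times> dom A) (dom S)"
    and lt: "\<And>x y. x \<in> {..<k} \<times> dom A \<Longrightarrow> y \<in> {..<k} \<times> dom A \<Longrightarrow>
      lt (A \<cdot> k) x y \<longleftrightarrow> lt S (h x) (h y)"
    using assms(2) unfolding isomorphic_def copies_def by (auto simp: times_def)
  \<comment> \<open>The \<open>i\<close>-th of the \<open>k * m\<close> copies of \<open>A\<close>
    is the copy \<open>i mod k\<close> of \<open>A\<close> inside the copy \<open>i div k\<close> of
    \<open>S\<close>.\<close>
  define g where "g = (\<lambda>(i, x). m * h (i mod k, x) + i div k)"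
  have div: "i div k < m" "i mod k < k" if "i < k * m" for i
    using that by (simp_all add: less_mult_imp_div_less mult.commute) (cases "k = 0"; simp)
  have gdiv: "g (i, x) div m = h (i mod k, x)" "g (i, x) mod m = i div k" if "i < k * m" for i x
    using div[OF that] assms(1) by (simp_all add: g_def)
  have "inj_on g ({..<k * m} \<times> dom A)"
  proof (rule inj_onI, clarsimp)
    fix i x j y
    assume *: "i < k * m" "x \<in> dom A" "j < k * m" "y \<in> dom A" "g (i, x) = g (j, y)"
    then have "h (i mod k, x) = h (j mod k, y)" "i div k = j div k"
      using gdiv by metis+
    then show "i = j \<and> x = y"
      using bij_betw_imp_inj_on[OF bij, THEN inj_onD, of "(i mod k, x)" "(j mod k, y)"] * div
      by (simp, metis div_mult_mod_eq)
  qed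
  moreover have "g ` ({..<k * m} \<times> dom A) = {u. u div m \<in> dom S}"
  proof (intro subset_antisym subsetI)
    fix u assume "u \<in> g ` ({..<k * m} \<times> dom A)"
    then show "u \<in> {u. u div m \<in> dom S}"
      using gdiv div bij_betwE[OF bij] by auto
  next
    fix u assume "u \<in> {u. u div m \<in> dom S}"
    then obtain i x where ix: "i < k" "x \<in> dom A" "h (i, x) = u div m"
      using bij_betw_imp_surj_on[OF bij] by force
    let ?j = "k * (u mod m) + i"
    have "?j < k * m"
    proof -
      have "?j < k * (u mod m) + k" using ix by simp
      also have "\<dots> = k * Suc (u mod m)" by simp
      also have "\<dots> \<le> k * m" using assms(1) by (intro mult_le_mono2) (simp add: Suc_leI)
      finally show ?thesis .
    qed
    moreover have "g (?j, x) = u"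
      using ix by (simp add: g_def)
    ultimately show "u \<in> g ` ({..<k * m} \<times> dom A)"
      using ix(2) by (metis SigmaI imageI lessThan_iff)
  qed
  ultimately have "bij_betw g (dom (A \<cdot> (k * m))) (dom (repeat m S))"
    by (simp add: bij_betw_def times_def repeat_def)
  moreover have "lt (A \<cdot> (k * m)) x y \<longleftrightarrow> lt (repeat m S) (g x) (g y)"
    if xy: "x \<in> dom (A \<cdot> (k * m))" "y \<in> dom (A \<cdot> (k * m))" for x y
  proof -
    obtain i a j b where ij: "x = (i, a)" "y = (j, b)" "i < k * m" "j < k * m" "a \<in> dom A" "b \<in> dom A"
      using xy by (auto simp: times_def)
    have "i < j \<longleftrightarrow> i div k < j div k \<or> (i div k = j div k \<and> i mod k < j mod k)"
      by (metis div_le_mono div_mult_mod_eq linorder_not_less nat_add_left_cancel_less nless_le)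
    moreover have "i = j \<longleftrightarrow> i div k = j div k \<and> i mod k = j mod k"
      by (metis div_mult_mod_eq)
    ultimately show ?thesis
      using ij gdiv lt[of "(i mod k, a)" "(j mod k, b)"] div
      by (auto simp: times_def repeat_def)
  qed
  ultimately show ?thesis
    unfolding copies_def isomorphic_def by blast
qed

text \<open>The kind \<open>a\<close> is the tag used by \<open>code_basic\<close>, so that codes of
  literals become arithmetic in \<open>a\<close>, \<open>x\<close> and \<open>y\<close>.\<close>

definition literal :: "nat \<Rightarrow> nat \<Rightarrow> nat \<Rightarrow> basic" where
  "literal a = (if a = 0 then Eq else if a = 1 then Neq else if a = 2 then Less else NotLess)"

lemma code_literal: "a < 4 \<Longrightarrow> code_basic (literal a x y) = prod_encode (a, prod_encode (x, y))"
  by (auto simp: literal_def)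

text \<open>A template \<open>(a, b, i, j)\<close> says that the literal of kind \<open>a\<close> between \<open>x\<close> and \<open>y\<close> yields the
  literal of kind \<open>b\<close> between the copy of \<open>x\<close> in part \<open>i\<close> and the copy of \<open>y\<close> in part \<open>j\<close>.\<close>

definition templates :: "nat \<Rightarrow> (nat \<times> nat \<times> nat \<times> nat) set" where
  "templates m = {(a, b, i, j). i < m \<and> j < m \<and>
     (a = 0 \<and> b = 0 \<and> i = j \<or> a = 1 \<and> b = 1 \<or> a = 0 \<and> b = 1 \<and> i \<noteq> j \<or>
      a = 2 \<and> b = 2 \<and> i \<le> j \<or> a = 3 \<and> b = 2 \<and> i < j \<or>
      a = 3 \<and> b = 3 \<and> j \<le> i \<or> a = 2 \<and> b = 3 \<and> j < i)}"

definition repeat_op :: "nat \<Rightarrow> (basic set \<times> basic) set" where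
  "repeat_op m = {({literal a x y}, literal b (m * x + i) (m * y + j)) | a b i j x y.
     (a, b, i, j) \<in> templates m}"

lemma templates_less: "(a, b, i, j) \<in> templates m \<Longrightarrow> a < 4 \<and> b < 4 \<and> i < m \<and> j < m"
  by (auto simp: templates_def)

lemma enumeration_operator_repeat_op: "enumeration_operator (repeat_op m)"
proof -
  \<comment> \<open>The canonical index of a singleton is a power of two; this also makes the code
    an upper bound for \<open>x\<close> and \<open>y\<close>.\<close>
  define c where "c = (\<lambda>(a, b, i, j) x y. prod_encode (2 ^ prod_encode (a, prod_encode (x, y)),
    prod_encode (b, prod_encode (m * x + i, m * y + j))))"
  have "code_pair ({literal a x y}, literal b (m * x + i) (m * y + j)) = c (a, b, i, j) x y"
    if "(a, b, i, j) \<in> templates m" for a b i j x y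
    using templates_less[OF that] by (simp add: code_pair_def code_literal c_def)
  then have "code_pair ` repeat_op m = {c i x y | i x y. i \<in> templates m}"
    unfolding repeat_op_def by (auto simp: image_def) metis+
  moreover have "ce_set {c i x y | i x y. i \<in> templates m}"
  proof (rule ce_set_bounded_range)
    have "templates m \<subseteq> {..<4} \<times> {..<4} \<times> {..<m} \<times> {..<m}"
      using templates_less by auto
    then show "finite (templates m)"
      by (rule finite_subset) simp
    show "total_computable 2 (\<lambda>xs. c p (xs ! 0) (xs ! 1))" for p
      by (cases p) (simp add: c_def total_computable_intros total_computable_prod_encode
          total_computable_power2 total_computable_add total_computable_mult)
    have *: "prod_encode (x, y) \<le> c p x y" for p x y
    proof (cases p)
      case (fields a b i j)
      have "prod_encode (x, y) \<le> prod_encode (a, prod_encode (x, y))"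
        by (rule le_prod_encode_2)
      also have "\<dots> \<le> 2 ^ prod_encode (a, prod_encode (x, y))"
        by (simp add: less_imp_le)
      also have "\<dots> \<le> c p x y"
        unfolding c_def fields by (simp add: le_prod_encode_1)
      finally show ?thesis .
    qed
    show "x \<le> c p x y" "y \<le> c p x y" for p x y
      using * le_prod_encode_1 le_prod_encode_2 le_trans by blast+
  qed
  ultimately show ?thesis
    unfolding enumeration_operator_def by (auto simp: repeat_op_def)
qed

lemma apply_repeat_op:
  assumes "m \<noteq> 0"
  shows "apply_op (repeat_op m) S = diagram (repeat m S)"
proof -
  have inj: "literal a x y = literal b u v \<longleftrightarrow> a = b \<and> x = u \<and> y = v" if "a < 4" "b < 4" for a b x y u v
    using that by (auto simp: literal_def split: if_splits)
  \<comment> \<open>Division by \<open>m\<close> recovers \<open>x\<close>, \<open>y\<close>,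
    \<open>i\<close>, \<open>j\<close> from \<open>u\<close> and \<open>v\<close>, so only the kind
    \<open>a\<close> of the premise remains open.\<close>
  have "literal b u v \<in> apply_op (repeat_op m) S \<longleftrightarrow>
      (\<exists>a. (a, b, u mod m, v mod m) \<in> templates m \<and> literal a (u div m) (v div m) \<in> diagram S)"
    if b: "b < 4" for b u v
  proof
    assume "literal b u v \<in> apply_op (repeat_op m) S"
    then obtain a b' i j x y where *: "(a, b', i, j) \<in> templates m" "literal a x y \<in> diagram S"
      "literal b u v = literal b' (m * x + i) (m * y + j)"
      unfolding apply_op_def repeat_op_def by auto
    then have "b' = b" "u = m * x + i" "v = m * y + j"
      using inj b templates_less by metis+
    with * show "\<exists>a. (a, b, u mod m, v mod m) \<in> templates m \<and> literal a (u div m) (v div m) \<in> diagram S"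
      using templates_less[OF *(1)] by auto
  next
    assume "\<exists>a. (a, b, u mod m, v mod m) \<in> templates m \<and> literal a (u div m) (v div m) \<in> diagram S"
    then obtain a where "(a, b, u mod m, v mod m) \<in> templates m" "literal a (u div m) (v div m) \<in> diagram S"
      by blast
    then have "({literal a (u div m) (v div m)}, literal b u v) \<in> repeat_op m"
      unfolding repeat_op_def mem_Collect_eq
      by (intro exI[of _ a] exI[of _ b] exI[of _ "u mod m"] exI[of _ "v mod m"]
          exI[of _ "u div m"] exI[of _ "v div m"]) simp
    then show "literal b u v \<in> apply_op (repeat_op m) S"
      unfolding apply_op_def using \<open>literal a (u div m) (v div m) \<in> diagram S\<close> by blast
  qed
  note * = this
  have "literal b u v \<in> apply_op (repeat_op m) S \<longleftrightarrow> literal b u v \<in> diagram (repeat m S)"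
    if b: "b \<in> {0, 1, 2, 3}" for b u v
  proof -
    have eq: "u = v \<longleftrightarrow> u div m = v div m \<and> u mod m = v mod m"
      by (metis div_mult_mod_eq)
    have op: "literal b u v \<in> apply_op (repeat_op m) S \<longleftrightarrow>
      (\<exists>a\<in>{0, 1, 2, 3}. (a, b, u mod m, v mod m) \<in> templates m \<and> literal a (u div m) (v div m) \<in> diagram S)"
    proof -
      have "a \<in> {0, 1, 2, 3}" if "(a, b, i, j) \<in> templates m" for a b i j
        using templates_less[OF that] by auto
      moreover have "b < 4"
        using that by auto
      ultimately show ?thesis
        using * by blast
    qed
    have mod: "u mod m < m" "v mod m < m"
      using assms by simp_all
    have "b = 0 \<or> b = 1 \<or> b = 2 \<or> b = 3"
      using b by blast
    then show ?thesis
    proof (elim disjE)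
      assume "b = 0"
      with mod show ?thesis
        unfolding op by (auto simp: literal_def diagram_def repeat_def templates_def eq)
    next
      assume "b = 1"
      with mod show ?thesis
        unfolding op by (auto simp: literal_def diagram_def repeat_def templates_def eq)
    next
      assume "b = 2"
      with mod show ?thesis
        unfolding op by (auto simp: literal_def diagram_def repeat_def templates_def)
    next
      assume "b = 3"
      with mod show ?thesis
        unfolding op by (auto simp: literal_def diagram_def repeat_def templates_def)
    qed
  qed
  note literals = this
  show ?thesis
  proof (rule set_eqI)
    fix \<phi>
    have "\<exists>b\<in>{0, 1, 2, 3}. \<exists>u v. \<phi> = literal b u v"
      by (cases \<phi>) (simp_all add: literal_def)
    then show "\<phi> \<in> apply_op (repeat_op m) S \<longleftrightarrow> \<phi> \<in> diagram (repeat m S)"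
      using literals by metis
  qed
qed

text \<open>The same operator serves both classes. It preserves and reflects isomorphism because
  source and target each have just two isomorphism types, which it does not mix.\<close>

lemma pair_le_c_if_dvd:
  assumes "k \<noteq> 0" "t \<noteq> 0" "k dvd t"
  shows "pair_le_c (omega \<cdot> k) (omega_star \<cdot> k) (omega \<cdot> t) (omega_star \<cdot> t)"
proof -
  obtain m where t: "t = k * m" and m: "m \<noteq> 0"
    using assms by (auto simp: dvd_def)
  have copies: "repeat m S \<in> copies (A \<cdot> t)" if "S \<in> copies (A \<cdot> k)" for S and A :: "nat ordstruct"
    using repeat_copies[OF m that] t by simp
  have disjoint: "\<not> S \<cong> T" if "S \<in> copies (omega \<cdot> n)" "T \<in> copies (omega_star \<cdot> n)" "n \<noteq> 0" for S T n
  proof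
    assume "S \<cong> T"
    with that(1) have "omega \<cdot> n \<cong> T"
      unfolding copies_def by (auto intro: isomorphic_trans)
    moreover have "T \<cong> omega_star \<cdot> n"
      using that(2) unfolding copies_def by (auto intro: isomorphic_sym)
    ultimately show False
      using not_isomorphic_omega_omega_star[OF that(3)] isomorphic_trans by blast
  qed
  have "A \<cong> B \<longleftrightarrow> repeat m A \<cong> repeat m B"
    if AB: "A \<in> copies (omega \<cdot> k) \<union> copies (omega_star \<cdot> k)"
      "B \<in> copies (omega \<cdot> k) \<union> copies (omega_star \<cdot> k)" for A B
  proof -
    have same: "A \<cong> B \<and> repeat m A \<cong> repeat m B"
      if "A \<in> copies (C \<cdot> k)" "B \<in> copies (C \<cdot> k)" for A B and C :: "nat ordstruct"
      using copies_isomorphic[OF that] copies_isomorphic[OF that[THEN copies]] by blast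
    have different: "\<not> A \<cong> B \<and> \<not> repeat m A \<cong> repeat m B"
      if "A \<in> copies (omega \<cdot> k)" "B \<in> copies (omega_star \<cdot> k)" for A B
      using disjoint[OF that assms(1)] disjoint[OF that[THEN copies] assms(2)] by blast
    show ?thesis
      using AB(1)
    proof
      assume A: "A \<in> copies (omega \<cdot> k)"
      show ?thesis
        using AB(2) same[OF A] different[OF A] by auto
    next
      assume A: "A \<in> copies (omega_star \<cdot> k)"
      show ?thesis
        using AB(2) same[OF A] different[OF _ A] by (auto dest: isomorphic_sym)
    qed
  qed
  note repeat_iff = this
  have "A \<cong> B \<longleftrightarrow> S \<cong> T"
    if AB: "A \<in> copies (omega \<cdot> k) \<union> copies (omega_star \<cdot> k)"
      "B \<in> copies (omega \<cdot> k) \<union> copies (omega_star \<cdot> k)"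
      and S: "diagram (repeat m A) = diagram S" and T: "diagram (repeat m B) = diagram T" for A B S T
  proof -
    note S = isomorphic_if_diagram_eq[OF S] and T = isomorphic_if_diagram_eq[OF T]
    have "repeat m A \<cong> repeat m B \<longleftrightarrow> S \<cong> T"
      using isomorphic_trans[OF S] isomorphic_trans[OF _ T] isomorphic_trans[OF isomorphic_sym[OF S]]
        isomorphic_trans[OF _ isomorphic_sym[OF T]] by blast
    then show ?thesis
      using repeat_iff[OF AB] by simp
  qed
  note equiv = this
  have op: "\<exists>T\<in>copies (A \<cdot> t). apply_op (repeat_op m) S = diagram T"
    if "S \<in> copies (A \<cdot> k)" for S and A :: "nat ordstruct"
    using copies[OF that] apply_repeat_op[OF m] by blast
  have "computable_embedding (repeat_op m) (copies (omega \<cdot> k) \<union> copies (omega_star \<cdot> k))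
      (copies (omega \<cdot> t) \<union> copies (omega_star \<cdot> t))"
    unfolding computable_embedding_def
  proof (intro conjI ballI allI impI)
    fix A assume "A \<in> copies (omega \<cdot> k) \<union> copies (omega_star \<cdot> k)"
    then show "\<exists>S\<in>copies (omega \<cdot> t) \<union> copies (omega_star \<cdot> t). apply_op (repeat_op m) A = diagram S"
      using op by (elim UnE) fast+
  qed (rule enumeration_operator_repeat_op, rule equiv, simp_all add: apply_repeat_op[OF m])
  then show ?thesis
    unfolding pair_le_c_def using op by (intro exI[of _ "repeat_op m"] conjI ballI)
qed

section \<open>Linear orders and their blocks\<close>

definition strict_linear :: "'a ordstruct \<Rightarrow> bool" where
  "strict_linear S \<longleftrightarrow> (\<forall>x\<in>dom S. \<not> lt S x x) \<and>
     (\<forall>x\<in>dom S. \<forall>y\<in>dom S. \<forall>z\<in>dom S. lt S x y \<longrightarrow> lt S y z \<longrightarrow> lt S x z) \<and>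
     (\<forall>x\<in>dom S. \<forall>y\<in>dom S. x = y \<or> lt S x y \<or> lt S y x)"

lemma strict_linearD:
  assumes "strict_linear S"
  shows "x \<in> dom S \<Longrightarrow> \<not> lt S x x"
    and "x \<in> dom S \<Longrightarrow> y \<in> dom S \<Longrightarrow> z \<in> dom S \<Longrightarrow> lt S x y \<Longrightarrow> lt S y z \<Longrightarrow> lt S x z"
    and "x \<in> dom S \<Longrightarrow> y \<in> dom S \<Longrightarrow> x = y \<or> lt S x y \<or> lt S y x"
    and "x \<in> dom S \<Longrightarrow> y \<in> dom S \<Longrightarrow> lt S x y \<Longrightarrow> \<not> lt S y x"
  using assms unfolding strict_linear_def by blast+

lemma strict_linear_times_omega: "strict_linear (omega \<cdot> k)" "strict_linear (omega_star \<cdot> k)"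
  unfolding strict_linear_def times_def omega_def omega_star_def by auto

lemma strict_linear_embed:
  assumes "strict_linear T" "inj_on h (dom S)" "h ` dom S \<subseteq> dom T"
    and "\<And>x y. x \<in> dom S \<Longrightarrow> y \<in> dom S \<Longrightarrow> lt S x y \<longleftrightarrow> lt T (h x) (h y)"
  shows "strict_linear S"
  unfolding strict_linear_def
proof (intro conjI ballI impI)
  fix x assume "x \<in> dom S"
  then show "\<not> lt S x x"
    using strict_linearD(1)[OF assms(1)] assms(3,4) by auto
next
  fix x y z assume "x \<in> dom S" "y \<in> dom S" "z \<in> dom S" "lt S x y" "lt S y z"
  then show "lt S x z"
    using strict_linearD(2)[OF assms(1), of "h x" "h y" "h z"] assms(3,4) by auto
next
  fix x y assume "x \<in> dom S" "y \<in> dom S"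
  then show "x = y \<or> lt S x y \<or> lt S y x"
    using strict_linearD(3)[OF assms(1), of "h x" "h y"] assms(3,4) inj_onD[OF assms(2), of x y] by auto
qed

lemma strict_linear_copies:
  assumes "S \<in> copies A" "strict_linear A"
  shows "strict_linear S"
proof -
  have "S \<cong> A"
    using assms(1) isomorphic_sym unfolding copies_def by blast
  then obtain h where "bij_betw h (dom S) (dom A)"
    "\<forall>x\<in>dom S. \<forall>y\<in>dom S. lt S x y \<longleftrightarrow> lt A (h x) (h y)"
    unfolding isomorphic_def by blast
  then show ?thesis
    using strict_linear_embed[OF assms(2), of h S] by (simp add: bij_betw_def)
qed

definition substructure :: "'a ordstruct \<Rightarrow> 'a ordstruct \<Rightarrow> bool" where
  "substructure F T \<longleftrightarrow> dom F \<subseteq> dom T \<and> (\<forall>x\<in>dom F. \<forall>y\<in>dom F. lt F x y \<longleftrightarrow> lt T x y)"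

lemma substructure_refl: "substructure T T"
  unfolding substructure_def by simp

lemma substructure_trans: "substructure F S \<Longrightarrow> substructure S T \<Longrightarrow> substructure F T"
  unfolding substructure_def by blast

lemma strict_linear_substructure: "substructure F T \<Longrightarrow> strict_linear T \<Longrightarrow> strict_linear F"
  unfolding substructure_def by (rule strict_linear_embed[of T id]) auto

definition restrict_dom :: "'a ordstruct \<Rightarrow> 'a set \<Rightarrow> 'a ordstruct" where
  "restrict_dom T X = \<lparr>dom = dom T \<inter> X, lt = lt T\<rparr>"

lemma substructure_restrict_dom: "substructure (restrict_dom T X) T"
  unfolding substructure_def restrict_dom_def by simp

lemma restrict_dom_mono: "X \<subseteq> Y \<Longrightarrow> substructure (restrict_dom T X) (restrict_dom T Y)"
  unfolding substructure_def restrict_dom_def by auto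

lemma substructure_restrict_domI: "substructure F T \<Longrightarrow> dom F \<subseteq> X \<Longrightarrow> substructure F (restrict_dom T X)"
  unfolding substructure_def restrict_dom_def by auto

text \<open>Counting predecessors is an isomorphism onto \<omega>: the predecessors of
  \<open>x\<close> take all the values below that of \<open>x\<close>, so the range is closed
  downwards, and it is infinite by injectivity.\<close>

lemma rank_bij:
  fixes r :: "'a \<Rightarrow> 'a \<Rightarrow> bool"
  defines "rank \<equiv> \<lambda>X x. card {y \<in> X. r y x}"
  assumes "infinite X"
    and fin: "\<And>x. x \<in> X \<Longrightarrow> finite {y \<in> X. r y x}"
    and irrefl: "\<And>x. x \<in> X \<Longrightarrow> \<not> r x x"
    and trans: "\<And>x y z. x \<in> X \<Longrightarrow> y \<in> X \<Longrightarrow> z \<in> X \<Longrightarrow> r x y \<Longrightarrow> r y z \<Longrightarrow> r x z"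
    and total: "\<And>x y. x \<in> X \<Longrightarrow> y \<in> X \<Longrightarrow> x = y \<or> r x y \<or> r y x"
  shows "bij_betw (rank X) X UNIV"
    and "\<And>x y. x \<in> X \<Longrightarrow> y \<in> X \<Longrightarrow> r x y \<longleftrightarrow> rank X x < rank X y"
proof -
  have less: "rank X x < rank X y" if "x \<in> X" "y \<in> X" "r x y" for x y
    unfolding rank_def using that trans irrefl by (intro psubset_card_mono fin) blast+
  show iff: "r x y \<longleftrightarrow> rank X x < rank X y" if "x \<in> X" "y \<in> X" for x y
    using less total that by (metis less_asym less_irrefl)
  have inj: "inj_on (rank X) X"
    using less total by (intro inj_onI) (metis less_irrefl)
  have below: "{..<rank X x} \<subseteq> rank X ` X" if "x \<in> X" for x
  proof -
    have "rank X ` {y \<in> X. r y x} = {..<rank X x}"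
    proof (rule card_subset_eq)
      show "rank X ` {y \<in> X. r y x} \<subseteq> {..<rank X x}"
        using less that by auto
      show "card (rank X ` {y \<in> X. r y x}) = card {..<rank X x}"
        using card_image[OF inj_on_subset[OF inj, of "{y \<in> X. r y x}"]] by (simp add: rank_def)
    qed simp
    then show ?thesis
      by (metis (mono_tags, lifting) image_mono mem_Collect_eq subsetI)
  qed
  have "infinite (rank X ` X)"
    using assms(2) inj finite_image_iff by blast
  then have "\<exists>m\<in>rank X ` X. n < m" for n
    unfolding infinite_nat_iff_unbounded by blast
  then have "n \<in> rank X ` X" for n
    using below by blast
  then show "bij_betw (rank X) X UNIV"
    using inj unfolding bij_betw_def by blast
qed

text \<open>Here \<open>f\<close> names the part of an element and \<open>g l\<close> numbers the
  elements of part \<open>l\<close>; together they are the isomorphism.\<close>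

lemma copies_timesI:
  fixes A :: "'a ordstruct"
  assumes "dom A = UNIV"
    and less: "\<And>x. x \<in> dom S \<Longrightarrow> f x < k"
    and linear: "strict_linear S"
    and mono: "\<And>x y. x \<in> dom S \<Longrightarrow> y \<in> dom S \<Longrightarrow> lt S x y \<Longrightarrow> f x \<le> f y"
    and bij: "\<And>l. l < k \<Longrightarrow> bij_betw (g l) {x \<in> dom S. f x = l} UNIV"
    and lt: "\<And>x y. x \<in> dom S \<Longrightarrow> y \<in> dom S \<Longrightarrow> f x = f y \<Longrightarrow>
      lt S x y \<longleftrightarrow> lt A (g (f x) x) (g (f x) y)"
  shows "S \<in> copies (A \<cdot> k)"
proof -
  let ?h = "\<lambda>x. (f x, g (f x) x)"
  have "bij_betw ?h (dom S) ({..<k} \<times> UNIV)"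
    unfolding bij_betw_def
  proof
    show "inj_on ?h (dom S)"
    proof (rule inj_onI)
      fix x y assume xy: "x \<in> dom S" "y \<in> dom S" "?h x = ?h y"
      then show "x = y"
        using bij_betw_imp_inj_on[OF bij[OF less[OF xy(1)]], THEN inj_onD, of x y] by auto
    qed
    show "?h ` dom S = {..<k} \<times> UNIV"
    proof (intro subset_antisym subsetI)
      fix p assume "p \<in> {..<k} \<times> (UNIV :: 'a set)"
      then obtain l a where p: "p = (l, a)" "l < k" by auto
      have "a \<in> g l ` {x \<in> dom S. f x = l}"
        using bij_betw_imp_surj_on[OF bij[OF p(2)]] by simp
      then obtain x where "x \<in> dom S" "f x = l" "g l x = a"
        by blast
      then show "p \<in> ?h ` dom S"
        using p by auto
    qed (use less in auto)
  qed
  moreover have "lt S x y \<longleftrightarrow> lt (A \<cdot> k) (?h x) (?h y)" if xy: "x \<in> dom S" "y \<in> dom S" for x y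
  proof (cases "f x = f y")
    case True
    then show ?thesis
      using lt[OF xy] by (simp add: times_def)
  next
    case False
    then have "lt S x y \<longleftrightarrow> f x < f y"
      using mono[OF xy] mono[OF xy(2,1)] strict_linearD(3)[OF linear xy] by (metis leD le_neq_implies_less)
    then show ?thesis
      using False by (simp add: times_def)
  qed
  ultimately have "S \<cong> A \<cdot> k"
    unfolding isomorphic_def using assms(1) by (intro exI[of _ ?h]) (simp add: times_def)
  then show ?thesis
    unfolding copies_def using isomorphic_sym by blast
qed

text \<open>Counting the predecessors inside a part numbers it in type \<omega>. All copies of
  \<open>omega \<cdot> k\<close> built below are recognised by this criterion.\<close>

lemma copies_times_omegaI:
  assumes linear: "strict_linear S"
    and less: "\<And>x. x \<in> dom S \<Longrightarrow> f x < k"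
    and mono: "\<And>x y. x \<in> dom S \<Longrightarrow> y \<in> dom S \<Longrightarrow> lt S x y \<Longrightarrow> f x \<le> f y"
    and inf: "\<And>l. l < k \<Longrightarrow> infinite {x \<in> dom S. f x = l}"
    and fin: "\<And>x. x \<in> dom S \<Longrightarrow> finite {y \<in> dom S. f y = f x \<and> lt S y x}"
  shows "S \<in> copies (omega \<cdot> k)"
proof -
  let ?g = "\<lambda>l x. card {y \<in> {z \<in> dom S. f z = l}. lt S y x}"
  have fin': "finite {y \<in> {z \<in> dom S. f z = l}. lt S y x}" if "x \<in> {z \<in> dom S. f z = l}" for l x
    using fin[of x] that by (auto elim: rev_finite_subset)
  have *: "bij_betw (?g l) {z \<in> dom S. f z = l} UNIV \<and>
      (\<forall>x\<in>{z \<in> dom S. f z = l}. \<forall>y\<in>{z \<in> dom S. f z = l}. lt S x y \<longleftrightarrow> ?g l x < ?g l y)"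
    if "l < k" for l
  proof -
    let ?X = "{z \<in> dom S. f z = l}" and ?r = "lt S"
    have "?r x z" if "x \<in> ?X" "y \<in> ?X" "z \<in> ?X" "?r x y" "?r y z" for x y z
      using strict_linearD(2)[OF linear] that by blast
    moreover have "\<not> ?r x x" if "x \<in> ?X" for x
      using strict_linearD(1)[OF linear] that by blast
    moreover have "x = y \<or> ?r x y \<or> ?r y x" if "x \<in> ?X" "y \<in> ?X" for x y
      using strict_linearD(3)[OF linear] that by blast
    ultimately show ?thesis
      by (intro conjI ballI rank_bij[of ?X ?r, OF inf[OF that] fin']) blast+
  qed
  show ?thesis
    by (rule copies_timesI[where f = f and g = ?g, OF _ less linear mono])
      (use * less in \<open>auto simp: omega_def\<close>)
qed

lemma copies_times_omega_starI:
  assumes linear: "strict_linear S"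
    and less: "\<And>x. x \<in> dom S \<Longrightarrow> f x < k"
    and mono: "\<And>x y. x \<in> dom S \<Longrightarrow> y \<in> dom S \<Longrightarrow> lt S x y \<Longrightarrow> f x \<le> f y"
    and inf: "\<And>l. l < k \<Longrightarrow> infinite {x \<in> dom S. f x = l}"
    and fin: "\<And>x. x \<in> dom S \<Longrightarrow> finite {y \<in> dom S. f y = f x \<and> lt S x y}"
  shows "S \<in> copies (omega_star \<cdot> k)"
proof -
  let ?g = "\<lambda>l x. card {y \<in> {z \<in> dom S. f z = l}. lt S x y}"
  have fin': "finite {y \<in> {z \<in> dom S. f z = l}. lt S x y}" if "x \<in> {z \<in> dom S. f z = l}" for l x
    using fin[of x] that by (auto elim: rev_finite_subset)
  have *: "bij_betw (?g l) {z \<in> dom S. f z = l} UNIV \<and>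
      (\<forall>x\<in>{z \<in> dom S. f z = l}. \<forall>y\<in>{z \<in> dom S. f z = l}. lt S y x \<longleftrightarrow> ?g l x < ?g l y)"
    if "l < k" for l
  proof -
    let ?X = "{z \<in> dom S. f z = l}" and ?r = "\<lambda>x y. lt S y x"
    have "?r x z" if "x \<in> ?X" "y \<in> ?X" "z \<in> ?X" "?r x y" "?r y z" for x y z
      using strict_linearD(2)[OF linear] that by blast
    moreover have "\<not> ?r x x" if "x \<in> ?X" for x
      using strict_linearD(1)[OF linear] that by blast
    moreover have "x = y \<or> ?r x y \<or> ?r y x" if "x \<in> ?X" "y \<in> ?X" for x y
      using strict_linearD(3)[OF linear] that by blast
    ultimately show ?thesis
      by (intro conjI ballI rank_bij[of ?X ?r, OF inf[OF that] fin']) blast+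
  qed
  show ?thesis
    by (rule copies_timesI[where f = f and g = ?g, OF _ less linear mono])
      (use * less in \<open>auto simp: omega_star_def\<close>)
qed

lemma times_coordinates:
  fixes A :: "nat ordstruct"
  assumes "S \<in> copies (A \<cdot> t)" "dom A = UNIV"
  obtains block rank where
    "\<And>x. x \<in> dom S \<Longrightarrow> block x < t"
    "\<And>x y. x \<in> dom S \<Longrightarrow> y \<in> dom S \<Longrightarrow>
      lt S x y \<longleftrightarrow> block x < block y \<or> (block x = block y \<and> lt A (rank x) (rank y))"
    "\<And>p n. p < t \<Longrightarrow> \<exists>x\<in>dom S. block x = p \<and> rank x = n"
proof -
  have "S \<cong> A \<cdot> t"
    using assms(1) isomorphic_sym unfolding copies_def by blast
  then obtain h where bij: "bij_betw h (dom S) ({..<t} \<times> UNIV)"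
    and lt: "\<And>x y. x \<in> dom S \<Longrightarrow> y \<in> dom S \<Longrightarrow> lt S x y \<longleftrightarrow> lt (A \<cdot> t) (h x) (h y)"
    unfolding isomorphic_def times_def using assms(2) by auto
  show thesis
  proof (rule that[of "fst \<circ> h" "snd \<circ> h"])
    show "(fst \<circ> h) x < t" if "x \<in> dom S" for x
      using bij_betwE[OF bij] that by (cases "h x") auto
    show "lt S x y \<longleftrightarrow> (fst \<circ> h) x < (fst \<circ> h) y \<or>
        ((fst \<circ> h) x = (fst \<circ> h) y \<and> lt A ((snd \<circ> h) x) ((snd \<circ> h) y))"
      if "x \<in> dom S" "y \<in> dom S" for x y
      using lt[OF that] by (cases "h x"; cases "h y") (simp add: times_def)
    show "\<exists>x\<in>dom S. (fst \<circ> h) x = p \<and> (snd \<circ> h) x = n" if "p < t" for p n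
      using bij_betw_imp_surj_on[OF bij] that
      by (metis (no_types, lifting) SigmaI UNIV_I comp_apply fst_conv imageE lessThan_iff snd_conv)
  qed
qed

section \<open>Ascending chains and the blocks they end in\<close>

lemma nondecreasing_bounded_eventually_constant:
  fixes f :: "nat \<Rightarrow> nat"
  assumes mono: "\<And>r s. r \<le> s \<Longrightarrow> f r \<le> f s" and "\<And>r. f r < t"
  shows "\<exists>v<t. \<exists>r0. \<forall>r\<ge>r0. f r = v"
proof -
  have fin: "finite (range f)"
    using assms(2) by (intro finite_subset[of "range f" "{..<t}"]) auto
  then have "Max (range f) \<in> range f"
    by (intro Max_in) auto
  then obtain r0 where "f r0 = Max (range f)"
    by auto
  then have "f r = f r0" if "r \<ge> r0" for r
    using mono[OF that] Max_ge[OF fin, of "f r"] by simp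
  then show ?thesis
    using assms(2) by blast
qed

lemma chain_unbounded:
  fixes f :: "nat \<Rightarrow> nat"
  assumes "\<And>r. r \<ge> r0 \<Longrightarrow> f r < f (Suc r)"
  shows "n \<le> f (r0 + n)"
proof (induction n)
  case (Suc n)
  with assms[of "r0 + n"] show ?case by simp
qed simp

text \<open>Block indices do not decrease along a chain and are bounded, so each chain ends in one
  block \<open>g p\<close>. There its ranks are unbounded, so no element of that block lies above
  the whole chain, and a higher chain must end in a later block.\<close>

lemma chains_meet_blocks:
  fixes rank :: "'a \<Rightarrow> nat" and s :: "nat \<Rightarrow> nat \<Rightarrow> 'a"
  assumes lt: "\<And>x y. x \<in> dom S \<Longrightarrow> y \<in> dom S \<Longrightarrow>
      lt S x y \<longleftrightarrow> block x < block y \<or> (block x = block y \<and> rank x < rank y)"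
    and block: "\<And>x. x \<in> dom S \<Longrightarrow> block x < (t :: nat)"
    and dom: "\<And>p r. p < a \<Longrightarrow> s p r \<in> dom S"
    and chain: "\<And>p q r. p < a \<Longrightarrow> q < r \<Longrightarrow> lt S (s p q) (s p r)"
    and above: "\<And>p p' q r. p < p' \<Longrightarrow> p' < a \<Longrightarrow> lt S (s p q) (s p' r)"
  obtains g :: "nat \<Rightarrow> nat" where "\<And>p. p < a \<Longrightarrow> g p < t"
    "\<And>p. p < a \<Longrightarrow> \<exists>r0. \<forall>r\<ge>r0. block (s p r) = g p"
    "\<And>p p'. p < p' \<Longrightarrow> p' < a \<Longrightarrow> g p < g p'"
proof -
  have "\<exists>v<t. \<exists>r0. \<forall>r\<ge>r0. block (s p r) = v" if p: "p < a" for p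
  proof (rule nondecreasing_bounded_eventually_constant)
    show "block (s p q) \<le> block (s p r)" if "q \<le> r" for q r
      using chain[OF p, of q r] lt[OF dom[OF p] dom[OF p]] that by (cases "q = r") auto
  qed (use block dom p in blast)
  then obtain g where g: "\<And>p. p < a \<Longrightarrow> g p < t" "\<And>p. p < a \<Longrightarrow> \<exists>r0. \<forall>r\<ge>r0. block (s p r) = g p"
    by metis
  have "g p < g p'" if p: "p < p'" "p' < a" for p p'
  proof -
    from p have pa: "p < a" by simp
    obtain r0 r0' where r0: "\<forall>r\<ge>r0. block (s p r) = g p" "\<forall>r\<ge>r0'. block (s p' r) = g p'"
      using g(2) pa p(2) by blast
    have "g p \<noteq> g p'"
    proof
      assume eq: "g p = g p'"
      have "rank (s p r) < rank (s p (Suc r))" if "r \<ge> r0" for r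
        using chain[OF pa, of r "Suc r"] lt[OF dom[OF pa] dom[OF pa]] r0(1) that by simp
      then have "n \<le> rank (s p (r0 + n))" for n
        by (rule chain_unbounded)
      moreover have "rank (s p (r0 + n)) < rank (s p' r0')" for n
        using above[OF p, of "r0 + n" r0'] lt[OF dom[OF pa] dom[OF p(2)]] r0 eq by simp
      ultimately show False
        by (meson leD)
    qed
    moreover have "g p \<le> g p'"
      using above[OF p, of r0 r0'] lt[OF dom[OF pa] dom[OF p(2)]] r0 by auto
    ultimately show ?thesis by simp
  qed
  with g show thesis
    using that by blast
qed

lemma chains_le:
  fixes s :: "nat \<Rightarrow> nat \<Rightarrow> nat"
  assumes "S \<in> copies (omega \<cdot> t)"
    and "\<And>p r. p < a \<Longrightarrow> s p r \<in> dom S"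
    and "\<And>p q r. p < a \<Longrightarrow> q < r \<Longrightarrow> lt S (s p q) (s p r)"
    and "\<And>p p' q r. p < p' \<Longrightarrow> p' < a \<Longrightarrow> lt S (s p q) (s p' r)"
  shows "a \<le> t"
proof -
  obtain block :: "nat \<Rightarrow> nat" and rank :: "nat \<Rightarrow> nat" where block: "\<And>x. x \<in> dom S \<Longrightarrow> block x < t"
    and lt: "\<And>x y. x \<in> dom S \<Longrightarrow> y \<in> dom S \<Longrightarrow>
      lt S x y \<longleftrightarrow> block x < block y \<or> (block x = block y \<and> rank x < rank y)"
    by (rule times_coordinates[OF assms(1), unfolded omega_def, simplified]) (erule that, assumption)
  obtain g :: "nat \<Rightarrow> nat" where g: "\<And>p. p < a \<Longrightarrow> g p < t"
    "\<And>p p'. p < p' \<Longrightarrow> p' < a \<Longrightarrow> g p < g p'"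
    by (rule chains_meet_blocks[where S = S and s = s and a = a, OF lt block assms(2-4)])
      (assumption+, erule that, assumption)
  have "inj_on g {..<a}"
    using g(2) by (intro inj_onI) (metis lessThan_iff less_irrefl linorder_neqE_nat)
  then show ?thesis
    using card_inj_on_le[of g "{..<a}" "{..<t}"] g(1) by auto
qed

lemma strict_mono_endo_id:
  fixes g :: "nat \<Rightarrow> nat"
  assumes "\<And>p. p < t \<Longrightarrow> g p < t" "\<And>p p'. p < p' \<Longrightarrow> p' < t \<Longrightarrow> g p < g p'" "p < t"
  shows "g p = p"
proof (rule antisym)
  show "p \<le> g p"
    using assms(3) by (induction p) (use assms(2) in \<open>auto simp: Suc_le_eq intro: le_less_trans\<close>)
  \<comment> \<open>Each of the \<open>d\<close> numbers after \<open>p\<close> needs its own value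
    above \<open>g p\<close>.\<close>
  have "g p + d < t" if "p + d < t" for d
    using that
  proof (induction d arbitrary: p)
    case (Suc d)
    then have "g (Suc p) + d < t" "g p < g (Suc p)"
      using assms(2) by simp_all
    then show ?case by simp
  qed (simp add: assms(1))
  from this[of "t - 1 - p"] show "g p \<le> p"
    using assms(3) by linarith
qed

lemma no_ascending_chain_times_omega_star:
  assumes "S \<in> copies (omega_star \<cdot> t)" "\<And>n. s n \<in> dom S" "\<And>n. lt S (s n) (s (Suc n))"
  shows False
proof -
  obtain block :: "nat \<Rightarrow> nat" and rank :: "nat \<Rightarrow> nat" where block: "\<And>x. x \<in> dom S \<Longrightarrow> block x < t"
    and lt: "\<And>x y. x \<in> dom S \<Longrightarrow> y \<in> dom S \<Longrightarrow>
      lt S x y \<longleftrightarrow> block x < block y \<or> (block x = block y \<and> rank y < rank x)"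
    by (rule times_coordinates[OF assms(1), unfolded omega_star_def, simplified]) (erule that, assumption)
  \<comment> \<open>On an ascending step either the block index grows or, within a block, the rank
    falls, so this pair decreases lexicographically.\<close>
  let ?f = "\<lambda>n. (t - block (s n), rank (s n))"
  have "wf (less_than <*lex*> less_than)"
    by blast
  moreover have "(?f (Suc n), ?f n) \<in> less_than <*lex*> less_than" for n
    using lt[OF assms(2) assms(2), of n "Suc n"] assms(3)[of n] block[OF assms(2)[of n]] block[OF assms(2)[of "Suc n"]]
    by (auto simp: less_diff_conv2)
  then have "\<exists>f. \<forall>n. (f (Suc n), f n) \<in> less_than <*lex*> less_than"
    by (intro exI[of _ ?f] allI)
  ultimately show False
    unfolding wf_iff_no_infinite_down_chain by (rule notE)
qed

section \<open>Finite inputs decide the order of the output\<close>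

text \<open>An enumeration operator reduced to monotonicity, finite use and its effect on the two
  classes. \<open>G\<close> also applies to finite orders, whose images need not be linear
  orders.\<close>

locale order_operator =
  fixes G :: "nat ordstruct \<Rightarrow> nat ordstruct" and k t :: nat
  assumes k_pos: "0 < k"
    and dom_mono: "\<And>S T. substructure S T \<Longrightarrow> dom (G S) \<subseteq> dom (G T)"
    and lt_mono: "\<And>S T b c. substructure S T \<Longrightarrow> lt (G S) b c \<Longrightarrow> lt (G T) b c"
    and dom_compact: "\<And>T b. b \<in> dom (G T) \<Longrightarrow>
      \<exists>X. finite X \<and> X \<subseteq> dom T \<and> b \<in> dom (G (restrict_dom T X))"
    and lt_compact: "\<And>T b c. lt (G T) b c \<Longrightarrow>
      \<exists>X. finite X \<and> X \<subseteq> dom T \<and> lt (G (restrict_dom T X)) b c"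
    and omega: "\<And>T. T \<in> copies (omega \<cdot> k) \<Longrightarrow> G T \<in> copies (omega \<cdot> t)"
    and omega_star: "\<And>T. T \<in> copies (omega_star \<cdot> k) \<Longrightarrow> G T \<in> copies (omega_star \<cdot> t)"
begin

definition good :: "nat ordstruct \<Rightarrow> bool" where
  "good T \<longleftrightarrow> T \<in> copies (omega \<cdot> k) \<union> copies (omega_star \<cdot> k)"

lemma good_strict_linear: "good T \<Longrightarrow> strict_linear T"
  unfolding good_def using strict_linear_copies strict_linear_times_omega by blast

lemma good_image_strict_linear: "good T \<Longrightarrow> strict_linear (G T)"
  unfolding good_def using omega omega_star strict_linear_copies strict_linear_times_omega by blast

lemma infinite_residue_class: "l < k \<Longrightarrow> infinite {x. M \<le> x \<and> x mod k = l}"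
proof -
  assume l: "l < k"
  have "\<exists>x>n. M \<le> x \<and> x mod k = l" for n
  proof (intro exI conjI)
    have "n + M < 1 * (n + M + 1)"
      by simp
    also have "\<dots> \<le> k * (n + M + 1)"
      using k_pos by (intro mult_le_mono1) simp
    also have "\<dots> \<le> l + k * (n + M + 1)"
      by (rule le_add2)
    finally have "n + M < l + k * (n + M + 1)" .
    then show "n < l + k * (n + M + 1)" "M \<le> l + k * (n + M + 1)"
      by linarith+
    show "(l + k * (n + M + 1)) mod k = l"
      using l by (simp only: mod_mult_self2 mod_less)
  qed
  then show ?thesis
    unfolding infinite_nat_iff_unbounded by blast
qed

text \<open>The residue of \<open>x > M\<close> modulo \<open>k\<close> is the index of its copy of \<open>\<omega>\<close>.\<close>

definition append_omega :: "nat ordstruct \<Rightarrow> nat \<Rightarrow> nat ordstruct" where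
  "append_omega F M = \<lparr>dom = dom F \<union> {M<..},
     lt = (\<lambda>x y. if x \<in> dom F then y \<in> dom F \<longrightarrow> lt F x y
       else y \<notin> dom F \<and> (x mod k < y mod k \<or> (x mod k = y mod k \<and> x < y)))\<rparr>"

text \<open>A finite order placed in front of a copy of \<omega> is absorbed by it, so
  \<open>F\<close> is counted to part \<open>0\<close>.\<close>

lemma append_omega_copy:
  assumes "strict_linear F" "finite (dom F)"
  shows "append_omega F M \<in> copies (omega \<cdot> k)"
proof (rule copies_times_omegaI[where f = "\<lambda>x. if x \<in> dom F then 0 else x mod k"])
  let ?S = "append_omega F M" and ?f = "\<lambda>x. if x \<in> dom F then 0 else x mod k"
  show "strict_linear ?S"
    unfolding strict_linear_def
  proof (intro conjI ballI impI)
    fix x assume "x \<in> dom ?S"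
    then show "\<not> lt ?S x x"
      using strict_linearD(1)[OF assms(1), of x] by (simp add: append_omega_def)
  next
    fix x y z assume "x \<in> dom ?S" "y \<in> dom ?S" "z \<in> dom ?S" "lt ?S x y" "lt ?S y z"
    then show "lt ?S x z"
      using strict_linearD(2)[OF assms(1), of x y z] by (auto simp: append_omega_def split: if_splits)
  next
    fix x y assume "x \<in> dom ?S" "y \<in> dom ?S"
    then show "x = y \<or> lt ?S x y \<or> lt ?S y x"
      using strict_linearD(3)[OF assms(1), of x y] by (auto simp: append_omega_def)
  qed
  show "?f x < k" for x
    using k_pos by simp
  show "?f x \<le> ?f y" if "lt ?S x y" for x y
    using that by (auto simp: append_omega_def split: if_splits)
  show "infinite {x \<in> dom ?S. ?f x = l}" if l: "l < k" for l
  proof -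
    obtain B where B: "dom F \<subseteq> {..B}"
      using assms(2) finite_nat_iff_bounded_le by blast
    have "{x. M + B + 1 \<le> x \<and> x mod k = l} \<subseteq> {x \<in> dom ?S. ?f x = l}"
    proof clarify
      fix x assume "M + B + 1 \<le> x" "l = x mod k"
      moreover from this have "x \<notin> dom F"
        using B by auto
      ultimately show "x \<in> dom ?S \<and> ?f x = x mod k"
        by (simp add: append_omega_def)
    qed
    then show ?thesis
      using infinite_residue_class[OF l] finite_subset by blast
  qed
  show "finite {y \<in> dom ?S. ?f y = ?f x \<and> lt ?S y x}" for x
    by (rule finite_subset[of _ "dom F \<union> {..x}"])
      (use assms(2) in \<open>auto simp: append_omega_def split: if_splits\<close>)
qed

lemma append_omega_good: "strict_linear F \<Longrightarrow> finite (dom F) \<Longrightarrow> good (append_omega F M)"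
  unfolding good_def using append_omega_copy by blast

lemma substructure_append_omega: "substructure F (append_omega F M)"
  unfolding substructure_def append_omega_def by simp

text \<open>The bound \<open>M\<close> keeps the elements added by \<open>F'\<close> out of the
  tail, so both orders have the same tail.\<close>

lemma append_omega_mono:
  assumes "substructure F F'" "dom F' \<subseteq> {..M}"
  shows "substructure (append_omega F M) (append_omega F' M)"
  using assms unfolding substructure_def append_omega_def by (auto split: if_splits)

text \<open>The relation in \<open>G T\<close> uses only a finite \<open>F'\<close> extending
  \<open>F\<close>. It therefore holds after appending to \<open>F'\<close>. Appending to
  \<open>F\<close> alone gives a smaller input that must also order \<open>b\<close> and
  \<open>c\<close>, and by monotonicity it cannot do so the other way.\<close>

lemma order_decided_after_append:
  assumes "good T" "substructure F T" "finite (dom F)" "b \<in> dom (G F)" "c \<in> dom (G F)" "lt (G T) b c"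
  shows "\<exists>M0. \<forall>M\<ge>M0. lt (G (append_omega F M)) b c"
proof -
  obtain X where X: "finite X" "X \<subseteq> dom T" "lt (G (restrict_dom T X)) b c"
    using lt_compact[OF assms(6)] by blast
  define F' where "F' = restrict_dom T (dom F \<union> X)"
  have F': "strict_linear F'" "finite (dom F')" "substructure F F'"
    using strict_linear_substructure[OF substructure_restrict_dom good_strict_linear[OF assms(1)]]
      X(1) assms(3) substructure_restrict_domI[OF assms(2)]
    by (auto simp: F'_def) (simp add: restrict_dom_def)
  have F: "strict_linear F"
    using strict_linear_substructure F'(1,3) by blast
  obtain M0 where M0: "dom F' \<subseteq> {..M0}"
    using F'(2) finite_nat_iff_bounded_le by blast
  have "lt (G (append_omega F M)) b c" if "M \<ge> M0" for M
  proof -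
    let ?A = "append_omega F M" and ?A' = "append_omega F' M"
    have sub: "substructure ?A ?A'"
      using append_omega_mono[OF F'(3)] M0 that by (meson atMost_subset_iff order_trans)
    have "lt (G F') b c"
      using lt_mono[OF restrict_dom_mono X(3)] unfolding F'_def by blast
    then have lt': "lt (G ?A') b c"
      using lt_mono substructure_append_omega by blast
    have bc: "b \<in> dom (G ?A)" "c \<in> dom (G ?A)" "b \<in> dom (G ?A')" "c \<in> dom (G ?A')"
      using dom_mono[OF substructure_append_omega] dom_mono[OF sub] assms(4,5) by blast+
    have A: "strict_linear (G ?A)" and A': "strict_linear (G ?A')"
      using good_image_strict_linear append_omega_good F F' assms(3) by blast+
    show ?thesis
      using strict_linearD(3)[OF A bc(1,2)] strict_linearD(1,4)[OF A'] bc(3,4) lt' lt_mono[OF sub] by blast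
  qed
  then show ?thesis by blast
qed

text \<open>Two extensions of a finite order \<open>F\<close> to the input class give the same order between the
  elements enumerated from \<open>F\<close>, since both are compatible with \<open>F\<close> followed by a copy of
  \<open>\<omega> \<cdot> k\<close> whose elements occur in neither computation.\<close>

lemma order_decided:
  assumes "good T" "good T'" "substructure F T" "substructure F T'" "finite (dom F)"
    and bc: "b \<in> dom (G F)" "c \<in> dom (G F)"
  shows "lt (G T) b c \<longleftrightarrow> lt (G T') b c"
proof -
  have "lt (G T') b c"
    if T: "good T" "substructure F T" and T': "good T'" "substructure F T'" and lt: "lt (G T) b c" for T T'
  proof (rule ccontr)
    assume "\<not> lt (G T') b c"
    moreover have "b \<noteq> c"
      using strict_linearD(1)[OF good_image_strict_linear[OF T(1)]] lt dom_mono[OF T(2)] bc by blast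
    ultimately have lt': "lt (G T') c b"
      using strict_linearD(3)[OF good_image_strict_linear[OF T'(1)]] dom_mono[OF T'(2)] bc by blast
    obtain M M' where M: "\<forall>N\<ge>M. lt (G (append_omega F N)) b c" "\<forall>N\<ge>M'. lt (G (append_omega F N)) c b"
      using order_decided_after_append[OF T assms(5) bc lt]
        order_decided_after_append[OF T' assms(5) bc(2,1) lt'] by blast
    let ?A = "append_omega F (max M M')"
    have "strict_linear (G ?A)"
      using good_image_strict_linear append_omega_good assms(5)
        strict_linear_substructure[OF T(2) good_strict_linear[OF T(1)]] by blast
    moreover have "b \<in> dom (G ?A)" "c \<in> dom (G ?A)"
      using dom_mono[OF substructure_append_omega] bc by blast+
    ultimately show False
      using M strict_linearD(4) by (meson max.cobounded1 max.cobounded2)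
  qed
  then show ?thesis
    using assms(1-4) by blast
qed

end

section \<open>Sampling the blocks of the output\<close>

text \<open>Real keys leave room between any two positions, as interpolation will need; breaking
  ties by number makes the order linear for all keys.\<close>

definition keyed :: "nat set \<Rightarrow> (nat \<Rightarrow> real) \<Rightarrow> nat ordstruct" where
  "keyed D \<kappa> = \<lparr>dom = D, lt = (\<lambda>x y. \<kappa> x < \<kappa> y \<or> (\<kappa> x = \<kappa> y \<and> x < y))\<rparr>"

lemma dom_keyed [simp]: "dom (keyed D \<kappa>) = D"
  by (simp add: keyed_def)

lemma lt_keyed: "lt (keyed D \<kappa>) x y \<longleftrightarrow> \<kappa> x < \<kappa> y \<or> (\<kappa> x = \<kappa> y \<and> x < y)"
  by (simp add: keyed_def)

lemma strict_linear_keyed: "strict_linear (keyed D \<kappa>)"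
  unfolding strict_linear_def lt_keyed by auto

text \<open>The blocks of \<open>S'\<close> are \<open>t\<close> stacked chains in \<open>S\<close>,
  so they end in \<open>t\<close> increasing blocks of \<open>S\<close>. A strictly increasing
  self-map of \<open>{..<t}\<close> is the identity, hence block \<open>j\<close> is met
  cofinally.\<close>

lemma substructure_meets_blocks:
  assumes S': "S' \<in> copies (omega \<cdot> t)" and sub: "substructure S' S"
    and block: "\<And>x. x \<in> dom S \<Longrightarrow> block x < t"
    and lt: "\<And>x y. x \<in> dom S \<Longrightarrow> y \<in> dom S \<Longrightarrow>
      lt S x y \<longleftrightarrow> block x < block y \<or> (block x = block y \<and> rank x < (rank y :: nat))"
    and "j < t"
  shows "\<exists>x\<in>dom S'. block x = j \<and> n < rank x"
proof -
  obtain block' :: "nat \<Rightarrow> nat" and rank' :: "nat \<Rightarrow> nat" where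
    lt': "\<And>x y. x \<in> dom S' \<Longrightarrow> y \<in> dom S' \<Longrightarrow>
      lt S' x y \<longleftrightarrow> block' x < block' y \<or> (block' x = block' y \<and> rank' x < rank' y)"
    and surj: "\<And>p n. p < t \<Longrightarrow> \<exists>x\<in>dom S'. block' x = p \<and> rank' x = n"
    by (rule times_coordinates[OF S', unfolded omega_def, simplified]) (rule that)
  define s where "s = (\<lambda>p r. SOME x. x \<in> dom S' \<and> block' x = p \<and> rank' x = r)"
  have s: "s p r \<in> dom S' \<and> block' (s p r) = p \<and> rank' (s p r) = r" if "p < t" for p r
    unfolding s_def by (rule someI_ex) (use surj[OF that] in blast)
  have lt_s: "lt S (s p q) (s p' r) \<longleftrightarrow> p < p' \<or> (p = p' \<and> q < r)" if "p < t" "p' < t" for p p' q r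
  proof -
    have "lt S (s p q) (s p' r) \<longleftrightarrow> lt S' (s p q) (s p' r)"
      using s[OF that(1), of q] s[OF that(2), of r] sub by (simp add: substructure_def)
    then show ?thesis
      using s[OF that(1), of q] s[OF that(2), of r] lt'[of "s p q" "s p' r"] by simp
  qed
  have dom: "s p r \<in> dom S" if "p < t" for p r
    using s[OF that] sub unfolding substructure_def by blast
  have chain: "lt S (s p q) (s p r)" if "p < t" "q < r" for p q r
    using lt_s that by simp
  have above: "lt S (s p q) (s p' r)" if "p < p'" "p' < t" for p p' q r
    using lt_s that by simp
  obtain g :: "nat \<Rightarrow> nat" where g: "\<And>p. p < t \<Longrightarrow> g p < t"
    "\<And>p. p < t \<Longrightarrow> \<exists>r0. \<forall>r\<ge>r0. block (s p r) = g p"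
    "\<And>p p'. p < p' \<Longrightarrow> p' < t \<Longrightarrow> g p < g p'"
    by (rule chains_meet_blocks[where S = S and s = s and a = t, OF lt block dom chain above])
      (assumption+, rule that)
  have "g j = j"
    using strict_mono_endo_id[of t g, OF g(1,3) assms(5)] by blast
  then obtain r0 where r0: "\<forall>r\<ge>r0. block (s j r) = j"
    using g(2)[OF assms(5)] by auto
  have "rank (s j r) < rank (s j (Suc r))" if "r \<ge> r0" for r
    using chain[OF assms(5), of r "Suc r"] lt[OF dom dom, OF assms(5) assms(5)] r0 that by simp
  then have "Suc n \<le> rank (s j (r0 + Suc n))"
    by (rule chain_unbounded)
  then show ?thesis
    using r0 s[OF assms(5)] by (intro bexI[of _ "s j (r0 + Suc n)"]) auto
qed

context order_operator
begin

text \<open>The parts are the residue classes modulo \<open>k\<close>, so that an interval of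
  numbers is a chunk reaching into all parts.\<close>

definition standard :: "nat ordstruct" where
  "standard = keyed UNIV (\<lambda>x. real (x mod k))"

lemma lt_standard: "lt standard x y \<longleftrightarrow> x mod k < y mod k \<or> (x mod k = y mod k \<and> x < y)"
  by (simp add: standard_def lt_keyed)

lemma dom_standard [simp]: "dom standard = UNIV"
  by (simp add: standard_def)

text \<open>As tails are again copies, samples of every block can be obtained from inputs beyond any
  bound.\<close>

lemma standard_tail: "restrict_dom standard {M..} \<in> copies (omega \<cdot> k)"
proof (rule copies_times_omegaI[where f = "\<lambda>x. x mod k"])
  show "strict_linear (restrict_dom standard {M..})"
    using strict_linear_substructure[OF substructure_restrict_dom] strict_linear_keyed standard_def by metis
  show "infinite {x \<in> dom (restrict_dom standard {M..}). x mod k = l}" if "l < k" for l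
    using infinite_residue_class[OF that, of M] by (simp add: restrict_dom_def)
  show "finite {y \<in> dom (restrict_dom standard {M..}). y mod k = x mod k \<and> lt (restrict_dom standard {M..}) y x}" for x
    by (rule finite_subset[of _ "{..x}"]) (auto simp: restrict_dom_def lt_standard)
qed (auto simp: restrict_dom_def lt_standard k_pos)

lemma standard_copy: "standard \<in> copies (omega \<cdot> k)"
proof -
  have "restrict_dom standard {0..} = standard"
    by (simp add: restrict_dom_def standard_def keyed_def)
  then show ?thesis
    using standard_tail[of 0] by simp
qed

text \<open>The smaller image already orders any two of its elements, and monotonicity forbids the
  larger one to differ.\<close>

lemma image_substructure:
  assumes "good S" "good T" "substructure S T"
  shows "substructure (G S) (G T)"
  unfolding substructure_def
proof (intro conjI ballI)
  show sub: "dom (G S) \<subseteq> dom (G T)"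
    by (rule dom_mono[OF assms(3)])
  fix x y assume xy: "x \<in> dom (G S)" "y \<in> dom (G S)"
  show "lt (G S) x y \<longleftrightarrow> lt (G T) x y"
    using strict_linearD(3)[OF good_image_strict_linear[OF assms(1)] xy]
      strict_linearD(1,4)[OF good_image_strict_linear[OF assms(2)]] sub xy lt_mono[OF assms(3)] by blast
qed

text \<open>Chunks are consecutive intervals, the fibres of \<open>idx\<close>. The image of the
  tail after a chunk meets each block above the last sample; by finite use an interval long enough
  to be the next chunk enumerates such elements alone.\<close>

lemma exists_samples:
  shows "\<exists>idx b. (\<forall>x y. x \<le> y \<longrightarrow> idx x \<le> idx y) \<and> (\<forall>n. finite {x. idx x = n}) \<and> surj idx \<and>
    (\<forall>n. \<forall>j<t. b n j \<in> dom (G (restrict_dom standard {x. idx x = n}))) \<and>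
    (\<forall>n m. \<forall>j<t. \<forall>j'<t. lt (G standard) (b n j) (b m j') \<longleftrightarrow> j < j' \<or> (j = j' \<and> n < (m :: nat)))"
proof -
  obtain block :: "nat \<Rightarrow> nat" and rank :: "nat \<Rightarrow> nat" where
    block: "\<And>x. x \<in> dom (G standard) \<Longrightarrow> block x < t"
    and lt: "\<And>x y. x \<in> dom (G standard) \<Longrightarrow> y \<in> dom (G standard) \<Longrightarrow>
      lt (G standard) x y \<longleftrightarrow> block x < block y \<or> (block x = block y \<and> rank x < rank y)"
    by (rule times_coordinates[OF omega[OF standard_copy], unfolded omega_def, simplified]) (erule that, assumption)
  have step: "\<exists>M'>M. \<exists>\<beta>. \<forall>j<t. \<beta> j \<in> dom (G (restrict_dom standard {M..<M'})) \<and>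
      block (\<beta> j) = j \<and> R < rank (\<beta> j)" for M R
  proof -
    have tail: "G (restrict_dom standard {M..}) \<in> copies (omega \<cdot> t)"
      by (rule omega[OF standard_tail])
    have sub: "substructure (G (restrict_dom standard {M..})) (G standard)"
      by (rule image_substructure) (use standard_tail standard_copy in \<open>auto simp: good_def substructure_restrict_dom\<close>)
    have "\<exists>x X. finite X \<and> X \<subseteq> {M..} \<and> x \<in> dom (G (restrict_dom standard X)) \<and> block x = j \<and> R < rank x"
      if j: "j < t" for j
    proof -
      obtain x where x: "x \<in> dom (G (restrict_dom standard {M..}))" "block x = j" "R < rank x"
        using substructure_meets_blocks[OF tail sub block lt j] by blast
      obtain X where X: "finite X" "X \<subseteq> {M..}" "x \<in> dom (G (restrict_dom (restrict_dom standard {M..}) X))"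
        using dom_compact[OF x(1)] by (auto simp: restrict_dom_def)
      moreover have "restrict_dom (restrict_dom standard {M..}) X = restrict_dom standard X"
        using X(2) by (auto simp: restrict_dom_def)
      ultimately show ?thesis
        using x(2,3) by metis
    qed
    then obtain \<beta> X where \<beta>: "\<And>j. j < t \<Longrightarrow> finite (X j) \<and> X j \<subseteq> {M..} \<and>
        \<beta> j \<in> dom (G (restrict_dom standard (X j))) \<and> block (\<beta> j) = j \<and> R < rank (\<beta> j)"
      by metis
    have "finite (\<Union>j<t. X j)"
      using \<beta> by auto
    then obtain B where B: "(\<Union>j<t. X j) \<subseteq> {..B}"
      using finite_nat_iff_bounded_le by blast
    have "\<beta> j \<in> dom (G (restrict_dom standard {M..<Suc (max M B)}))" if "j < t" for j
    proof -
      have "X j \<subseteq> {M..<Suc (max M B)}"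
        using B \<beta>[OF that] that by (fastforce simp: less_Suc_eq_le)
      then show ?thesis
        using dom_mono[OF restrict_dom_mono] \<beta>[OF that] by blast
    qed
    then show ?thesis
      using \<beta> by (intro exI[of _ "Suc (max M B)"]) (auto simp: less_Suc_eq_le)
  qed
  \<comment> \<open>A state consists of a chunk \<open>{lo..<hi}\<close> and its samples
    \<open>\<beta>\<close>; \<open>Q\<close> makes the next chunk start where this one ends and its
    samples have larger ranks.\<close>
  define P :: "nat \<Rightarrow> nat \<times> nat \<times> (nat \<Rightarrow> nat) \<Rightarrow> bool" where
    "P = (\<lambda>n (lo, hi, \<beta>). lo < hi \<and> (n = 0 \<longrightarrow> lo = 0) \<and>
      (\<forall>j<t. \<beta> j \<in> dom (G (restrict_dom standard {lo..<hi})) \<and> block (\<beta> j) = j))"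
  define Q :: "nat \<Rightarrow> nat \<times> nat \<times> (nat \<Rightarrow> nat) \<Rightarrow> nat \<times> nat \<times> (nat \<Rightarrow> nat) \<Rightarrow> bool" where
    "Q = (\<lambda>n (lo, hi, \<beta>) (lo', hi', \<beta>'). lo' = hi \<and> (\<forall>j<t. rank (\<beta> j) < rank (\<beta>' j)))"
  have "\<exists>f. \<forall>n. P n (f n) \<and> Q n (f n) (f (Suc n))"
  proof (rule dependent_nat_choice)
    obtain hi \<beta> where "hi > 0" "\<forall>j<t. \<beta> j \<in> dom (G (restrict_dom standard {0..<hi})) \<and> block (\<beta> j) = j"
      using step[of 0 0] by blast
    then show "\<exists>x. P 0 x"
      by (intro exI[of _ "(0, hi, \<beta>)"]) (simp add: P_def)
    fix x n assume "P n x"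
    obtain lo hi \<beta> where x: "x = (lo, hi, \<beta>)"
      by (cases x)
    obtain hi' \<beta>' where *: "hi' > hi" "\<forall>j<t. \<beta>' j \<in> dom (G (restrict_dom standard {hi..<hi'})) \<and>
        block (\<beta>' j) = j \<and> (\<Sum>j<t. rank (\<beta> j)) < rank (\<beta>' j)"
      \<comment> \<open>The sum serves as a common upper bound for the ranks of all present
        samples.\<close>
      using step[of hi "\<Sum>j<t. rank (\<beta> j)"] by blast
    have "rank (\<beta> j) \<le> (\<Sum>j<t. rank (\<beta> j))" if "j < t" for j
      using that by (intro member_le_sum) auto
    with * show "\<exists>y. P (Suc n) y \<and> Q n x y"
      by (intro exI[of _ "(hi, hi', \<beta>')"]) (auto simp: P_def Q_def x intro: le_less_trans)
  qed
  then obtain f where f: "\<And>n. P n (f n)" "\<And>n. Q n (f n) (f (Suc n))"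
    by blast
  define s where "s n = fst (f n)" for n
  define b where "b n = snd (snd (f n))" for n
  have hi: "fst (snd (f n)) = s (Suc n)" for n
    using f(2)[of n] by (auto simp: Q_def s_def split: prod.splits)
  have s: "s n < s (Suc n)" "s 0 = 0" for n
    using f(1)[of n] f(1)[of 0] hi[of n] by (auto simp: P_def s_def split: prod.splits)
  have b: "b n j \<in> dom (G (restrict_dom standard {s n..<s (Suc n)}))" "block (b n j) = j" if "j < t" for n j
    using f(1)[of n] hi[of n] that by (auto simp: P_def s_def b_def split: prod.splits)
  have b_rank: "rank (b n j) < rank (b (Suc n) j)" if "j < t" for n j
    using f(2)[of n] that by (auto simp: Q_def b_def split: prod.splits)
  have s_mono: "strict_mono s"
    using s(1) by (simp add: strict_mono_Suc_iff)
  define idx where "idx x = (LEAST n. x < s (Suc n))" for x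
  have idx: "idx x = n \<longleftrightarrow> s n \<le> x \<and> x < s (Suc n)" for x n
  proof
    have "x < s (Suc x)"
      using seq_suble[OF s_mono, of "Suc x"] by simp
    then have "x < s (Suc (idx x))"
      unfolding idx_def by (rule LeastI)
    moreover have "s (idx x) \<le> x"
    proof (cases "idx x")
      case (Suc m)
      then have "\<not> x < s (Suc m)"
        using not_less_Least[of m "\<lambda>n. x < s (Suc n)"] by (simp add: idx_def)
      with Suc show ?thesis by simp
    qed (simp add: s)
    ultimately show "s n \<le> x \<and> x < s (Suc n)" if "idx x = n"
      using that by blast
  next
    assume *: "s n \<le> x \<and> x < s (Suc n)"
    show "idx x = n"
      unfolding idx_def
    proof (rule Least_equality)
      show "n \<le> m" if "x < s (Suc m)" for m
        using * that strict_mono_less[OF s_mono, of n "Suc m"] by linarith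
    qed (use * in blast)
  qed
  have "idx x \<le> idx y" if "x \<le> y" for x y
  proof -
    have "s (idx x) < s (Suc (idx y))"
      using idx[of x "idx x"] idx[of y "idx y"] that by simp
    then show ?thesis
      using strict_mono_less[OF s_mono] by simp
  qed
  moreover have "{x. idx x = n} = {s n..<s (Suc n)}" for n
    using idx by auto
  moreover have "surj idx"
    by (rule surjI[of _ s]) (simp add: idx s)
  moreover have "lt (G standard) (b n j) (b m j') \<longleftrightarrow> j < j' \<or> (j = j' \<and> n < m)"
    if "j < t" "j' < t" for n m j j'
  proof -
    have "b n j \<in> dom (G standard)" if "j < t" for n j
      using b(1)[OF that] dom_mono[OF substructure_restrict_dom] by blast
    moreover have "rank (b n j) < rank (b m j) \<longleftrightarrow> n < m"
      using strict_mono_less[of "\<lambda>n. rank (b n j)"] b_rank[OF that(1)] by (simp add: strict_mono_Suc_iff)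
    ultimately show ?thesis
      using lt[of "b n j" "b m j'"] b(2) that by auto
  qed
  ultimately show ?thesis
    using b(1) by (intro exI[of _ idx] exI[of _ b]) simp
qed

end

section \<open>Homogeneous samples\<close>

definition increasing :: "nat \<Rightarrow> (nat \<Rightarrow> real) \<Rightarrow> bool" where
  "increasing k u \<longleftrightarrow> (\<forall>c d. c < d \<longrightarrow> d < k \<longrightarrow> u c < u d)"

lemma increasing_le: "increasing k u \<Longrightarrow> c \<le> d \<Longrightarrow> d < k \<Longrightarrow> u c \<le> u d"
  unfolding increasing_def by (metis less_imp_le order_le_less)

lemma increasing_less_iff: "increasing k u \<Longrightarrow> c < k \<Longrightarrow> d < k \<Longrightarrow> u c < u d \<longleftrightarrow> c < d"
  unfolding increasing_def by (metis linorder_less_linear order_less_asym)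

text \<open>Here \<open>u\<close> belongs to the earlier chunk. Equality counts as being below
  because ties are broken by number and earlier chunks have smaller numbers.\<close>

definition pattern :: "nat \<Rightarrow> (nat \<Rightarrow> real) \<Rightarrow> (nat \<Rightarrow> real) \<Rightarrow> (nat \<times> nat) set" where
  "pattern k u v = {(c, d). c < k \<and> d < k \<and> u c \<le> v d}"

locale sampled_operator = order_operator +
  fixes idx :: "nat \<Rightarrow> nat" and b :: "nat \<Rightarrow> nat \<Rightarrow> nat"
  assumes idx_mono: "x \<le> y \<Longrightarrow> idx x \<le> idx y"
    and idx_finite: "finite {x. idx x = n}"
    and idx_surj: "surj idx"
    and sample_dom: "j < t \<Longrightarrow> b n j \<in> dom (G (restrict_dom standard {x. idx x = n}))"
    and sample_lt: "j < t \<Longrightarrow> j' < t \<Longrightarrow>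
      lt (G standard) (b n j) (b m j') \<longleftrightarrow> j < j' \<or> (j = j' \<and> n < m)"
begin

text \<open>The part \<open>c\<close> of the \<open>n\<close>-th chunk consists of the \<open>x\<close> with \<open>idx x = n\<close> and \<open>x mod k = c\<close>;
  it is placed as a whole at the position \<open>U n c\<close>.\<close>

definition arrangement :: "nat set \<Rightarrow> (nat \<Rightarrow> nat \<Rightarrow> real) \<Rightarrow> nat ordstruct" where
  "arrangement N U = keyed {x. idx x \<in> N} (\<lambda>x. U (idx x) (x mod k))"

lemma idx_less: "idx x < idx y \<Longrightarrow> x < y"
  using idx_mono[of y x] by (meson leD not_le_imp_less)

lemma finite_idx_vimage: "finite N \<Longrightarrow> finite {x. idx x \<in> N}"
proof -
  assume "finite N"
  then have "finite (\<Union>n\<in>N. {x. idx x = n})"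
    using idx_finite by blast
  moreover have "{x. idx x \<in> N} = (\<Union>n\<in>N. {x. idx x = n})"
    by blast
  ultimately show ?thesis by simp
qed

lemma arrangement_mono:
  assumes "N \<subseteq> N'" "\<And>n. n \<in> N \<Longrightarrow> U n = U' n"
  shows "substructure (arrangement N U) (arrangement N' U')"
  using assms unfolding substructure_def arrangement_def by (auto simp: lt_keyed)

text \<open>Increasing positions leave the order inside a chunk unchanged, so its samples are
  enumerated wherever it is placed.\<close>

lemma chunk_substructure_arrangement:
  assumes "n \<in> N" "increasing k (U n)"
  shows "substructure (restrict_dom standard {x. idx x = n}) (arrangement N U)"
proof -
  have "U n (x mod k) < U n (y mod k) \<longleftrightarrow> x mod k < y mod k" for x y
    using increasing_less_iff[OF assms(2)] k_pos by simp
  moreover from this have "U n (x mod k) = U n (y mod k) \<longleftrightarrow> x mod k = y mod k" for x y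
    by (metis linorder_less_linear less_irrefl)
  ultimately show ?thesis
    using assms(1) by (auto simp: substructure_def arrangement_def restrict_dom_def lt_keyed lt_standard)
qed

lemma sample_dom_arrangement:
  assumes "j < t" "n \<in> N" "increasing k (U n)"
  shows "b n j \<in> dom (G (arrangement N U))"
  using dom_mono[OF chunk_substructure_arrangement[where N = N and U = U, OF assms(2,3)]]
    sample_dom[OF assms(1)] by blast

lemma sample_eq:
  assumes "j < t" "j' < t"
  shows "b n j = b m j' \<longleftrightarrow> n = m \<and> j = j'"
proof
  assume eq: "b n j = b m j'"
  have "\<not> lt (G standard) (b n j) (b n j)"
    using sample_lt[OF assms(1,1)] by simp
  then have "\<not> lt (G standard) (b n j) (b m j')" "\<not> lt (G standard) (b m j') (b n j)"
    using eq by simp_all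
  then show "n = m \<and> j = j'"
    using sample_lt[OF assms] sample_lt[OF assms(2,1)] by (metis linorder_less_linear)
qed simp

definition pair :: "nat \<Rightarrow> nat \<Rightarrow> (nat \<Rightarrow> real) \<Rightarrow> (nat \<Rightarrow> real) \<Rightarrow> nat ordstruct" where
  "pair n m u v = arrangement {n, m} (\<lambda>i. if i = n then u else v)"

text \<open>Inside each chunk the order is the standard one, and between the two chunks it is what
  the pattern records.\<close>

lemma pair_pattern:
  assumes "n < m" "increasing k u" "increasing k v" "increasing k u'" "increasing k v'"
    and "pattern k u v = pattern k u' v'"
  shows "substructure (pair n m u v) (pair n m u' v')"
proof -
  have uv: "u c \<le> v d \<longleftrightarrow> u' c \<le> v' d" if "c < k" "d < k" for c d
    using assms(6) that unfolding pattern_def by blast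
  have mod: "x mod k < k" for x
    using k_pos by simp
  have incr: "w (x mod k) < w (y mod k) \<or> (w (x mod k) = w (y mod k) \<and> x < y) \<longleftrightarrow> lt standard x y"
    if "increasing k w" for w x y
    using increasing_less_iff[OF that mod mod, of x y] increasing_less_iff[OF that mod mod, of y x]
    unfolding lt_standard by (metis linorder_less_linear)
  have "lt (pair n m u v) x y \<longleftrightarrow> lt (pair n m u' v') x y"
    if xy: "idx x \<in> {n, m}" "idx y \<in> {n, m}" for x y
  proof -
    consider "idx x = n" "idx y = n" | "idx x = m" "idx y = m" | "idx x = n" "idx y = m" | "idx x = m" "idx y = n"
      using xy by blast
    then show ?thesis
    proof cases
      case 1
      then show ?thesis
        using incr[OF assms(2)] incr[OF assms(4)] by (simp add: pair_def arrangement_def lt_keyed)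
    next
      case 2
      then show ?thesis
        using incr[OF assms(3)] incr[OF assms(5)] assms(1) by (simp add: pair_def arrangement_def lt_keyed)
    next
      case 3
      then have "x < y"
        using idx_less assms(1) by simp
      then show ?thesis
        using 3 uv[OF mod[of x] mod[of y]] assms(1)
        by (simp add: pair_def arrangement_def lt_keyed flip: order_le_less)
    next
      case 4
      then have "\<not> x < y"
        using idx_less[of y x] assms(1) by simp
      then show ?thesis
        using 4 uv[OF mod[of y] mod[of x]] assms(1)
        by (simp add: pair_def arrangement_def lt_keyed flip: not_le)
    qed
  qed
  then show ?thesis
    by (auto simp: substructure_def pair_def arrangement_def)
qed

text \<open>The answers for all blocks and patterns at once form a subset of a fixed finite set, as
  Ramsey's theorem requires. By \<open>order_decided\<close> the choice of \<open>u\<close>,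
  \<open>v\<close> and \<open>T\<close> does not affect them.\<close>

definition colour :: "nat \<Rightarrow> nat \<Rightarrow> (nat \<times> nat \<times> (nat \<times> nat) set) set" where
  "colour n m = {(j, j', p). j < t \<and> j' < t \<and> (\<exists>u v T. increasing k u \<and> increasing k v \<and>
     p = pattern k u v \<and> good T \<and> substructure (pair n m u v) T \<and> lt (G T) (b n j) (b m j'))}"

lemma colour_iff:
  assumes "n < m" "increasing k u" "increasing k v" "j < t" "j' < t" "good T" "substructure (pair n m u v) T"
  shows "(j, j', pattern k u v) \<in> colour n m \<longleftrightarrow> lt (G T) (b n j) (b m j')"
proof
  assume "(j, j', pattern k u v) \<in> colour n m"
  then obtain u' v' T' where *: "increasing k u'" "increasing k v'" "pattern k u v = pattern k u' v'"
    "good T'" "substructure (pair n m u' v') T'" "lt (G T') (b n j) (b m j')"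
    unfolding colour_def by blast
  have "substructure (pair n m u v) T'"
    using substructure_trans[OF pair_pattern[OF assms(1-3) *(1-3)] *(5)] .
  moreover have "finite (dom (pair n m u v))"
    using finite_idx_vimage[of "{n, m}"] by (simp add: pair_def arrangement_def)
  moreover have "b n j \<in> dom (G (pair n m u v))" "b m j' \<in> dom (G (pair n m u v))"
    unfolding pair_def using assms(1-5) by (auto intro!: sample_dom_arrangement)
  ultimately show "lt (G T) (b n j) (b m j')"
    using order_decided[OF assms(6) *(4) assms(7)] *(6) by blast
next
  assume "lt (G T) (b n j) (b m j')"
  then show "(j, j', pattern k u v) \<in> colour n m"
    unfolding colour_def using assms by blast
qed

lemma exists_homogeneous: "\<exists>Y A. infinite Y \<and> (\<forall>n\<in>Y. \<forall>m\<in>Y. n < m \<longrightarrow> colour n m = A)"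
proof -
  let ?C = "Pow ({..<t} \<times> {..<t} \<times> Pow ({..<k} \<times> {..<k}))"
  obtain h where h: "bij_betw h ?C {0..<card ?C}"
    using ex_bij_betw_finite_nat[of ?C] by auto
  have C: "colour n m \<in> ?C" for n m
    by (auto simp: colour_def pattern_def)
  \<comment> \<open>Ramsey's theorem colours two-element sets by numbers, so the colours are
    numbered by \<open>h\<close> and the pair is put in increasing order.\<close>
  let ?f = "\<lambda>X. h (colour (Min X) (Max X))"
  have "?f X < card ?C" for X
    using bij_betwE[OF h] C by (metis atLeastLessThan_iff)
  then obtain Y c where Y: "infinite Y" "\<forall>n\<in>Y. \<forall>m\<in>Y. n \<noteq> m \<longrightarrow> ?f {n, m} = c"
    using Ramsey2[of "UNIV :: nat set" ?f "card ?C"] by blast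
  then have "h (colour n m) = c" if "n \<in> Y" "m \<in> Y" "n < m" for n m
    using that by (metis Max_insert Max_singleton Min_insert Min_singleton finite.emptyI finite.insertI
        insert_not_empty less_imp_le max.absorb2 min.absorb1 order_less_irrefl)
  then have "colour n m = inv_into ?C h c" if "n \<in> Y" "m \<in> Y" "n < m" for n m
    using that C bij_betw_inv_into_left[OF h] by metis
  then show ?thesis
    using Y(1) by blast
qed

end

section \<open>The total preorder of blocks and positions\<close>

locale homogeneous_operator = sampled_operator +
  fixes Y A
  assumes infinite_Y: "infinite Y"
    and colour_Y: "n \<in> Y \<Longrightarrow> m \<in> Y \<Longrightarrow> n < m \<Longrightarrow> colour n m = A"
begin

text \<open>\<open>below (j, u) (j', v)\<close> says that for \<open>n < m\<close> in \<open>Y\<close>, if the \<open>n\<close>-th chunk is placed at \<open>u\<close> and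
  the \<open>m\<close>-th at \<open>v\<close>, then the \<open>j\<close>-th sample of the former is below the \<open>j'\<close>-th sample of the
  latter. Chunks placed at equal positions are ordered by their index, so that \<open>u\<close> and \<open>v\<close> may
  overlap; this makes \<open>below\<close> a total preorder.\<close>

definition below :: "nat \<times> (nat \<Rightarrow> real) \<Rightarrow> nat \<times> (nat \<Rightarrow> real) \<Rightarrow> bool" where
  "below = (\<lambda>(j, u) (j', v). (j, j', pattern k u v) \<in> A)"

lemma below_cong: "pattern k u v = pattern k u' v' \<Longrightarrow> below (j, u) (j', v) \<longleftrightarrow> below (j, u') (j', v')"
  by (simp add: below_def)

definition point :: "nat \<times> (nat \<Rightarrow> real) \<Rightarrow> bool" where
  "point = (\<lambda>(j, u). j < t \<and> increasing k u)"

lemma point_iff [simp]: "point (j, u) \<longleftrightarrow> j < t \<and> increasing k u"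
  by (simp add: point_def)

lemma lt_samples_iff:
  assumes "good T" "substructure (arrangement N U) T" "n \<in> N" "m \<in> N" "n \<in> Y" "m \<in> Y" "n < m"
    and "point (j, U n)" "point (j', U m)"
  shows "lt (G T) (b n j) (b m j') \<longleftrightarrow> below (j, U n) (j', U m)"
proof -
  have "substructure (pair n m (U n) (U m)) (arrangement N U)"
    unfolding pair_def using assms by (intro arrangement_mono) auto
  then have "substructure (pair n m (U n) (U m)) T"
    using assms(2) substructure_trans by blast
  then show ?thesis
    using colour_iff[OF assms(7) _ _ _ _ assms(1), of "U n" "U m" j j'] colour_Y[OF assms(5-7)] assms(8,9)
    by (simp add: below_def)
qed

text \<open>\<open>below\<close> speaks of the chunk with the smaller index first. A strict relation
  settles both cases: if \<open>m < n\<close>, failure of the converse rules out the opposite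
  order.\<close>

lemma lt_samples_if_strictly_below:
  assumes "good T" "substructure (arrangement N U) T" "n \<in> N" "m \<in> N" "n \<in> Y" "m \<in> Y" "n \<noteq> m"
    and "point (j, U n)" "point (j', U m)"
    and "below (j, U n) (j', U m)" "\<not> below (j', U m) (j, U n)"
  shows "lt (G T) (b n j) (b m j')"
proof (cases "n < m")
  case True
  then show ?thesis
    using lt_samples_iff[OF assms(1-6) _ assms(8,9)] assms(10) by blast
next
  case False
  then have "\<not> lt (G T) (b m j') (b n j)"
    using lt_samples_iff[OF assms(1,2,4,3,6,5) _ assms(9,8)] assms(7,11) by simp
  moreover have "b n j \<in> dom (G T)" "b m j' \<in> dom (G T)"
    using sample_dom_arrangement dom_mono[OF assms(2)] assms by (auto simp: subset_iff)
  moreover have "b n j \<noteq> b m j'"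
    using sample_eq assms(7,8,9) by simp
  ultimately show ?thesis
    using strict_linearD(3)[OF good_image_strict_linear[OF assms(1)]] by blast
qed

lemma three_indices: "\<exists>n m l. n \<in> Y \<and> m \<in> Y \<and> l \<in> Y \<and> n < m \<and> m < l"
proof -
  have "\<exists>m\<in>Y. n < m" for n
    using infinite_Y unfolding infinite_nat_iff_unbounded by blast
  then show ?thesis
    by meson
qed

text \<open>Three chunks with indices in \<open>Y\<close> realise any three points, even equal ones,
  in one linear order, so laws of linear orders carry over to \<open>below\<close>.\<close>

lemma three_points:
  assumes "point p" "point q" "point r"
  obtains S :: "nat ordstruct" and x y z where "strict_linear S" "x \<in> dom S" "y \<in> dom S" "z \<in> dom S"
    "x \<noteq> y" "y \<noteq> z" "x \<noteq> z"
    "lt S x y \<longleftrightarrow> below p q" "lt S y z \<longleftrightarrow> below q r" "lt S x z \<longleftrightarrow> below p r"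
proof -
  obtain n m l where Y: "n \<in> Y" "m \<in> Y" "l \<in> Y" "n < m" "m < l"
    using three_indices by blast
  obtain i u j v h w where eqs: "p = (i, u)" "q = (j, v)" "r = (h, w)"
    by (cases p, cases q, cases r)
  define N U where "N = {n, m, l}" and "U = (\<lambda>a. if a = n then u else if a = m then v else w)"
  have N: "n \<in> N" "m \<in> N" "l \<in> N" and U: "U n = u" "U m = v" "U l = w"
    using Y by (auto simp: N_def U_def)
  \<comment> \<open>The finite arrangement is completed to a copy of \<open>omega \<cdot> k\<close>,
    where the operator is known to give a linear order.\<close>
  define T where "T = append_omega (arrangement N U) 0"
  have sub: "substructure (arrangement N U) T"
    unfolding T_def by (rule substructure_append_omega)
  have T: "good T"
    unfolding T_def using finite_idx_vimage[of N]
    by (intro append_omega_good) (auto simp: arrangement_def strict_linear_keyed N_def)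
  have points: "point (i, U n)" "point (j, U m)" "point (h, U l)"
    using assms eqs U by auto
  show thesis
  proof (rule that[of "G T" "b n i" "b m j" "b l h"])
    show "strict_linear (G T)"
      by (rule good_image_strict_linear[OF T])
    show "b n i \<in> dom (G T)" "b m j \<in> dom (G T)" "b l h \<in> dom (G T)"
      using sample_dom_arrangement N points dom_mono[OF sub] by (auto simp: subset_iff)
    show "b n i \<noteq> b m j" "b m j \<noteq> b l h" "b n i \<noteq> b l h"
      using sample_eq points Y by auto
    show "lt (G T) (b n i) (b m j) \<longleftrightarrow> below p q"
      using lt_samples_iff[OF T sub N(1,2) Y(1,2,4) points(1,2)] eqs U by simp
    show "lt (G T) (b m j) (b l h) \<longleftrightarrow> below q r"
      using lt_samples_iff[OF T sub N(2,3) Y(2,3,5) points(2,3)] eqs U by simp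
    show "lt (G T) (b n i) (b l h) \<longleftrightarrow> below p r"
      using lt_samples_iff[OF T sub N(1,3) Y(1,3) _ points(1,3)] Y(4,5) eqs U by simp
  qed
qed

lemma below_trans:
  assumes "point p" "point q" "point r" "below p q" "below q r"
  shows "below p r"
proof -
  obtain S :: "nat ordstruct" and x y z where S: "strict_linear S" "x \<in> dom S" "y \<in> dom S" "z \<in> dom S"
    "x \<noteq> y" "y \<noteq> z" "x \<noteq> z"
    "lt S x y \<longleftrightarrow> below p q" "lt S y z \<longleftrightarrow> below q r" "lt S x z \<longleftrightarrow> below p r"
    by (rule three_points[OF assms(1-3)])
  then show ?thesis
    using strict_linearD(2)[OF S(1-4)] assms(4,5) by blast
qed

lemma below_cotrans:
  assumes "point p" "point q" "point r" "below p r"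
  shows "below p q \<or> below q r"
proof -
  obtain S :: "nat ordstruct" and x y z where S: "strict_linear S" "x \<in> dom S" "y \<in> dom S" "z \<in> dom S"
    "x \<noteq> y" "y \<noteq> z" "x \<noteq> z"
    "lt S x y \<longleftrightarrow> below p q" "lt S y z \<longleftrightarrow> below q r" "lt S x z \<longleftrightarrow> below p r"
    by (rule three_points[OF assms(1-3)])
  have "lt S x y \<or> lt S y z"
    using strict_linearD(3)[OF S(1), of x y] strict_linearD(3)[OF S(1), of y z]
      strict_linearD(2)[OF S(1), of z y x] strict_linearD(4)[OF S(1), of x z] S(2-7,10) assms(4) by blast
  then show ?thesis
    using S(8,9) by blast
qed

text \<open>The hypotheses place the chunks as in the standard copy: in each part the earlier before
  the later, and the parts apart. There samples are sorted by block first.\<close>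

lemma below_standard:
  assumes "j < t" "j' < t" "increasing k u" "increasing k v"
    and "\<And>c. c < k \<Longrightarrow> u c \<le> v c" "\<And>c. Suc c < k \<Longrightarrow> v c < u (Suc c)"
  shows "below (j, u) (j', v) \<longleftrightarrow> j \<le> j'"
proof -
  have "v d < u c" if "d < c" "c < k" for c d
    using assms(6)[of d] increasing_le[OF assms(3), of "Suc d" c] that by (meson Suc_leI order.strict_trans1 less_le_trans)
  moreover have "u c \<le> v d" if "c \<le> d" "d < k" for c d
    using increasing_le[OF assms(3) that] assms(5)[OF that(2)] by simp
  ultimately have "u c \<le> v d \<longleftrightarrow> c \<le> d" if "c < k" "d < k" for c d
    using that by (meson leD not_le_imp_less)
  then have "pattern k u v = pattern k real real"
    unfolding pattern_def by auto
  then have "below (j, u) (j', v) \<longleftrightarrow> below (j, real) (j', real)"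
    by (rule below_cong)
  moreover obtain n m where nm: "n \<in> Y" "m \<in> Y" "n < m"
    using three_indices by blast
  \<comment> \<open>With all chunks at the same positions, breaking ties by number yields the
    standard copy.\<close>
  moreover have "arrangement UNIV (\<lambda>_. real) = standard"
    by (simp add: arrangement_def standard_def)
  then have "lt (G standard) (b n j) (b m j') \<longleftrightarrow> below (j, real) (j', real)"
    using lt_samples_iff[of standard UNIV "\<lambda>_. real" n m j j'] nm assms(1,2) standard_copy
    by (simp add: good_def substructure_refl increasing_def)
  ultimately show ?thesis
    using sample_lt[OF assms(1,2), of n m] by auto
qed

lemma below_refl: "point p \<Longrightarrow> below p p"
  using below_standard by (cases p) (auto simp: increasing_def)

lemma below_total: "point p \<Longrightarrow> point q \<Longrightarrow> below p q \<or> below q p"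
  using below_cotrans[of p q p] below_refl by blast

text \<open>The copy of \<open>\<omega>\<^sup>\<star> \<cdot> k\<close> obtained from the standard one by reversing the order of the
  chunks inside each part.\<close>

lemma not_below_reversed:
  assumes "j < t" "increasing k u" "increasing k v"
    and "\<And>c. c < k \<Longrightarrow> v c < u c" "\<And>c. Suc c < k \<Longrightarrow> u c < v (Suc c)"
  shows "\<not> below (j, u) (j, v)"
proof
  assume below: "below (j, u) (j, v)"
  \<comment> \<open>In part \<open>c\<close> the chunks descend towards \<open>c\<close> as their
    index grows, without leaving the interval from \<open>c\<close> to \<open>c + 1\<close>.\<close>
  define U where "U = (\<lambda>n c. real c + 1 / (real n + 2))"
  have U_bounds: "real c < U n c" "U n c < real c + 1" for n c
    by (auto simp: U_def field_simps)
  have U_incr: "increasing k (U n)" for n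
    by (simp add: increasing_def U_def)
  have U_less: "U m c < U n c \<longleftrightarrow> n < m" for n m c
    by (simp add: U_def field_simps)
  have "u c \<le> v d \<longleftrightarrow> c < d" if "c < k" "d < k" for c d
  proof
    assume "u c \<le> v d"
    then show "c < d"
      using assms(4)[OF that(1)] increasing_le[OF assms(3), of d c] that by fastforce
  next
    assume "c < d"
    then show "u c \<le> v d"
      using assms(5)[of c] increasing_le[OF assms(3), of "Suc c" d] that by fastforce
  qed
  moreover have "U n c \<le> U m d \<longleftrightarrow> c < d" if "n < m" for n m c d
  proof -
    have "U m d < U n c" if "d \<le> c"
      using U_less[of m c n] \<open>n < m\<close> that by (simp add: U_def)
    moreover have "U n c \<le> U m d" if "c < d"
    proof -
      have "real c + 1 \<le> real d"
        using that by linarith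
      then show ?thesis
        using U_bounds(2)[of n c] U_bounds(1)[of d m] by linarith
    qed
    ultimately show ?thesis
      by (meson leD not_le_imp_less)
  qed
  ultimately have pattern_eq: "pattern k u v = pattern k (U n) (U m)" if "n < m" for n m
    using that unfolding pattern_def by auto
  \<comment> \<open>The samples of block \<open>j\<close> from chunks in \<open>Y\<close> would thus
    ascend forever inside a copy of \<open>omega_star \<cdot> t\<close>.\<close>
  have below_U: "below (j, U n) (j, U m)" if "n < m" for n m
    using below below_cong[OF pattern_eq[OF that], of j j] by simp
  let ?T = "arrangement UNIV U"
  have T: "?T \<in> copies (omega_star \<cdot> k)"
  proof (rule copies_times_omega_starI[where f = "\<lambda>x. x mod k"])
    show "strict_linear ?T"
      by (simp add: arrangement_def strict_linear_keyed)
    show "x mod k \<le> y mod k" if "lt ?T x y" for x y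
    proof (rule ccontr)
      assume "\<not> x mod k \<le> y mod k"
      then have "real (y mod k) + 1 \<le> real (x mod k)"
        by linarith
      then have "U (idx y) (y mod k) < U (idx x) (x mod k)"
        using U_bounds(2)[of "idx y" "y mod k"] U_bounds(1)[of "x mod k" "idx x"] by linarith
      with that show False
        by (simp add: arrangement_def lt_keyed)
    qed
    show "infinite {x \<in> dom ?T. x mod k = l}" if "l < k" for l
      using infinite_residue_class[OF that, of 0] by (simp add: arrangement_def)
    show "finite {y \<in> dom ?T. y mod k = x mod k \<and> lt ?T x y}" for x
    proof (rule finite_subset[of _ "{y. idx y \<in> {..idx x}}"])
      show "{y \<in> dom ?T. y mod k = x mod k \<and> lt ?T x y} \<subseteq> {y. idx y \<in> {..idx x}}"
      proof
        fix y assume "y \<in> {y \<in> dom ?T. y mod k = x mod k \<and> lt ?T x y}"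
        then have "\<not> U (idx y) (x mod k) < U (idx x) (x mod k)"
          by (auto simp: arrangement_def lt_keyed)
        then show "y \<in> {y. idx y \<in> {..idx x}}"
          unfolding U_less by simp
      qed
    qed (rule finite_idx_vimage, simp)
  qed (use k_pos in auto)
  have good: "good ?T"
    using T by (simp add: good_def)
  let ?e = "enumerate Y"
  have e: "?e n \<in> Y" "?e n < ?e (Suc n)" for n
    using enumerate_in_set[OF infinite_Y] enumerate_step[OF infinite_Y] by auto
  show False
  proof (rule no_ascending_chain_times_omega_star[OF omega_star[OF T]])
    show "b (?e n) j \<in> dom (G ?T)" for n
      using sample_dom_arrangement assms(1) U_incr by simp
    show "lt (G ?T) (b (?e n) j) (b (?e (Suc n)) j)" for n
      using lt_samples_iff[OF good substructure_refl UNIV_I UNIV_I e(1) e(1) e(2)] below_U[OF e(2)]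
        assms(1) U_incr by simp
  qed
qed

end

section \<open>Dictators\<close>

lemma increasingI:
  assumes "\<And>c. Suc c < k \<Longrightarrow> u c < u (Suc c)"
  shows "increasing k u"
  unfolding increasing_def
proof (intro allI impI)
  fix c d :: nat assume "c < d" "d < k"
  then show "u c < u d"
  proof (induction d)
    case (Suc d)
    then show ?case
      using assms[of d] by (cases "c = d") auto
  qed simp
qed

text \<open>Such positions can be compared coordinate by coordinate: the pattern is determined by
  the set of \<open>c\<close> with \<open>u c \<le> v c\<close>, like a profile of votes.\<close>

definition separated :: "nat \<Rightarrow> (nat \<Rightarrow> real) \<Rightarrow> (nat \<Rightarrow> real) \<Rightarrow> bool" where
  "separated k u v \<longleftrightarrow> (\<forall>c. Suc c < k \<longrightarrow> u c < u (Suc c) \<and> u c < v (Suc c) \<and> v c < u (Suc c) \<and> v c < v (Suc c))"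

lemma separated_increasing: "separated k u v \<Longrightarrow> increasing k u" "separated k u v \<Longrightarrow> increasing k v"
  unfolding separated_def by (auto intro: increasingI)

lemma separated_commute: "separated k u v \<Longrightarrow> separated k v u"
  unfolding separated_def by blast

lemma pattern_separated:
  assumes "separated k u v" "c < k" "d < k"
  shows "u c \<le> v d \<longleftrightarrow> c < d \<or> (c = d \<and> u c \<le> v c)"
proof -
  have "u c < v d" if "c < d"
  proof -
    have "u c < v (Suc c)"
      using assms that by (simp add: separated_def)
    also have "\<dots> \<le> v d"
      using increasing_le[OF separated_increasing(2)[OF assms(1)]] assms(3) that by simp
    finally show ?thesis .
  qed
  moreover have "v d < u c" if "d < c"
  proof -
    have "v d < u (Suc d)"
      using assms that by (simp add: separated_def)
    also have "\<dots> \<le> u c"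
      using increasing_le[OF separated_increasing(1)[OF assms(1)]] assms(2) that by simp
    finally show ?thesis .
  qed
  ultimately show ?thesis
    by (metis leD less_imp_le linorder_less_linear)
qed

lemma pattern_eqI:
  assumes "separated k u v" "separated k u' v'" "\<And>c. c < k \<Longrightarrow> u c \<le> v c \<longleftrightarrow> u' c \<le> v' c"
  shows "pattern k u v = pattern k u' v'"
proof -
  have "u c \<le> v d \<longleftrightarrow> u' c \<le> v' d" if "c < k" "d < k" for c d
    using pattern_separated[OF assms(1) that] pattern_separated[OF assms(2) that] assms(3)[OF that(1)] by simp
  then show ?thesis
    unfolding pattern_def by auto
qed

lemma uniform_gap:
  assumes "increasing k u"
  shows "\<exists>\<delta>>0. \<forall>c. Suc c < k \<longrightarrow> u c + \<delta> \<le> u (Suc c)"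
proof -
  \<comment> \<open>The element \<open>1\<close> keeps the set nonempty when
    \<open>k = 1\<close>.\<close>
  let ?D = "insert 1 ((\<lambda>c. u (Suc c) - u c) ` {c. Suc c < k})"
  have fin: "finite ?D"
    by (intro finite.insertI finite_imageI finite_subset[of "{c. Suc c < k}" "{..<k}"]) auto
  then have "0 < Min ?D"
    using assms by (auto simp: Min_gr_iff increasing_def)
  moreover have "u c + Min ?D \<le> u (Suc c)" if "Suc c < k" for c
    using Min_le[OF fin, of "u (Suc c) - u c"] that by auto
  ultimately show ?thesis
    by blast
qed

context homogeneous_operator
begin

text \<open>From \<open>stair 0\<close> to \<open>stair k\<close> the coordinates are raised one at
  a time, as in the search for a pivotal voter.\<close>

definition stair :: "nat \<Rightarrow> nat \<Rightarrow> real" where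
  "stair s c = 2 * real c + (if c < s then 1 else 0)"

definition dictates :: "nat \<Rightarrow> nat \<Rightarrow> bool" where
  "dictates i j \<longleftrightarrow> i < k \<and> \<not> below (j, stair (Suc i)) (j, stair i)"

lemma separated_stair: "separated k (stair s) (stair s')"
  by (auto simp: separated_def stair_def)

text \<open>If no coordinate were pivotal, transitivity would lead from \<open>stair k\<close> down
  to \<open>stair 0\<close>, against \<open>not_below_reversed\<close>; this is where the copies of
  \<open>omega_star \<cdot> k\<close> enter.\<close>

lemma exists_dictator:
  assumes "j < t"
  shows "\<exists>i. dictates i j"
proof (rule ccontr)
  assume "\<nexists>i. dictates i j"
  then have step: "below (j, stair (Suc i)) (j, stair i)" if "i < k" for i
    using that unfolding dictates_def by blast
  have point: "point (j, stair s)" for s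
    using assms separated_increasing(1)[OF separated_stair] by simp
  have "below (j, stair s) (j, stair 0)" if "s \<le> k" for s
    using that
  proof (induction s)
    case 0
    then show ?case
      using below_refl[OF point] by blast
  next
    case (Suc s)
    then show ?case
      using below_trans[OF point point point step[of s]] by simp
  qed
  moreover have "\<not> below (j, stair k) (j, stair 0)"
    using assms separated_increasing(1)[OF separated_stair]
    by (intro not_below_reversed) (auto simp: stair_def)
  ultimately show False
    by blast
qed

text \<open>Raising only the coordinate \<open>i\<close> raises the sample strictly, hence so does every separated
  change that raises it: otherwise composing with a weakly increasing change of the other
  coordinates would contradict the choice of \<open>i\<close>.\<close>

lemma dictator_separated_strict:
  assumes "dictates i j" "j < t" "separated k u v" "u i < v i"
  shows "\<not> below (j, v) (j, u)"
proof
  assume below: "below (j, v) (j, u)"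
  \<comment> \<open>The pair \<open>x\<close>, \<open>y\<close> has the pattern of \<open>v\<close>,
    \<open>u\<close>; \<open>z\<close> is nowhere lower than \<open>y\<close>; and \<open>x\<close>
    exceeds \<open>z\<close> only at \<open>i\<close>, as \<open>stair (Suc i)\<close> exceeds
    \<open>stair i\<close>.\<close>
  define x y z where "x = (\<lambda>c. 3 * real c + 1)"
    and "y = (\<lambda>c. 3 * real c + (if v c \<le> u c then 1 else 0))"
    and "z = (\<lambda>c. 3 * real c + (if c = i then 0 else 1))"
  have sep: "separated k x y" "separated k x z" "separated k y z"
    by (auto simp: separated_def x_def y_def z_def)
  note incr = separated_increasing[OF sep(1)] separated_increasing(2)[OF sep(2)]
  have "pattern k v u = pattern k x y"
    by (rule pattern_eqI[OF separated_commute[OF assms(3)] sep(1)]) (auto simp: x_def y_def)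
  then have xy: "below (j, x) (j, y)"
    using below below_cong by blast
  have yz: "below (j, y) (j, z)"
    using below_standard[OF assms(2,2) incr(2,3)] assms(4) by (auto simp: y_def z_def)
  have "below (j, x) (j, z)"
    using below_trans[OF _ _ _ xy yz] incr assms(2) by simp
  moreover have "pattern k x z = pattern k (stair (Suc i)) (stair i)"
    by (rule pattern_eqI[OF sep(2) separated_stair]) (auto simp: x_def z_def stair_def)
  ultimately show False
    using assms(1) below_cong unfolding dictates_def by blast
qed

text \<open>A pattern does not distinguish a tie from a rise, so \<open>u\<close> and
  \<open>v\<close> may be replaced by positions without ties; the strict case and totality then
  apply.\<close>

lemma dictator_separated:
  assumes "dictates i j" "j < t" "separated k u v" "u i \<le> v i"
  shows "below (j, u) (j, v)"
proof -
  define x y where "x = (\<lambda>c. 3 * real c + 1)" and "y = (\<lambda>c. 3 * real c + (if u c \<le> v c then 2 else 0))"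
  have sep: "separated k x y"
    by (auto simp: separated_def x_def y_def)
  have "\<not> below (j, y) (j, x)"
    by (rule dictator_separated_strict[OF assms(1,2) sep]) (use assms(4) in \<open>simp add: x_def y_def\<close>)
  then have "below (j, x) (j, y)"
    using below_total[of "(j, x)" "(j, y)"] assms(2) separated_increasing[OF sep] by simp
  moreover have "pattern k u v = pattern k x y"
    by (rule pattern_eqI[OF assms(3) sep]) (auto simp: x_def y_def)
  ultimately show ?thesis
    using below_cong by blast
qed

text \<open>Linear interpolation in small steps reduces the general case to separated positions.\<close>

lemma dictator_le:
  assumes "dictates i j" "j < t" "increasing k u" "increasing k v" "u i \<le> v i"
  shows "below (j, u) (j, v)"
proof -
  obtain \<delta>1 \<delta>2 where \<delta>1: "\<delta>1 > 0" "\<And>c. Suc c < k \<Longrightarrow> u c + \<delta>1 \<le> u (Suc c)"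
    and \<delta>2: "\<delta>2 > 0" "\<And>c. Suc c < k \<Longrightarrow> v c + \<delta>2 \<le> v (Suc c)"
    using uniform_gap[OF assms(3)] uniform_gap[OF assms(4)] by blast
  define \<delta> where "\<delta> = min \<delta>1 \<delta>2"
  define B where "B = (\<Sum>c<k. \<bar>v c - u c\<bar>) + 1"
  have \<delta>: "\<delta> > 0" "\<And>c. Suc c < k \<Longrightarrow> \<delta> \<le> u (Suc c) - u c" "\<And>c. Suc c < k \<Longrightarrow> \<delta> \<le> v (Suc c) - v c"
    using \<delta>1 \<delta>2 by (fastforce simp: \<delta>_def)+
  have B: "\<bar>v c - u c\<bar> < B" if "c < k" for c
    using that member_le_sum[of c "{..<k}" "\<lambda>c. \<bar>v c - u c\<bar>"] by (simp add: B_def)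
  have "B > 0"
    by (simp add: B_def sum_nonneg add_nonneg_pos)
  \<comment> \<open>With \<open>N\<close> steps every coordinate moves by less than the gap
    \<open>\<delta>\<close>, which all convex combinations keep, so consecutive positions are
    separated.\<close>
  obtain N where N: "B / \<delta> < real N"
    using reals_Archimedean2 by blast
  have N_pos: "0 < real N"
    using N \<open>B > 0\<close> \<delta>(1) by (metis divide_pos_pos less_trans)
  define w where "w = (\<lambda>s c. u c + real s / real N * (v c - u c))"
  have gap: "\<delta> \<le> w s (Suc c) - w s c" if "s \<le> N" "Suc c < k" for s c
  proof -
    define r where "r = real s / real N"
    have r: "0 \<le> r" "r \<le> 1"
      using that(1) N_pos by (auto simp: r_def)
    have w: "w s c = u c + r * (v c - u c)" for c
      by (simp add: w_def r_def)
    have "\<delta> = (1 - r) * \<delta> + r * \<delta>"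
      by (simp add: algebra_simps)
    also have "\<dots> \<le> (1 - r) * (u (Suc c) - u c) + r * (v (Suc c) - v c)"
      using r \<delta>(2,3)[OF that(2)] by (intro add_mono mult_left_mono) auto
    also have "\<dots> = w s (Suc c) - w s c"
      by (simp add: w algebra_simps)
    finally show ?thesis .
  qed
  have diff: "w (Suc s) c - w s c = (v c - u c) / real N" for s c
    by (simp add: w_def add_divide_distrib algebra_simps diff_divide_distrib)
  have step: "\<bar>w (Suc s) c - w s c\<bar> < \<delta>" if "c < k" for s c
  proof -
    have "\<bar>v c - u c\<bar> / real N < B / real N"
      using B[OF that] N_pos by (simp add: divide_strict_right_mono)
    also have "\<dots> < \<delta>"
      using N N_pos \<delta>(1) by (simp add: field_simps)
    finally show ?thesis
      by (simp add: diff abs_divide)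
  qed
  have sep: "separated k (w s) (w (Suc s))" if "Suc s \<le> N" for s
    unfolding separated_def
  proof (intro allI impI)
    fix c assume c: "Suc c < k"
    then have "c < k" by simp
    from gap[of s c] gap[of "Suc s" c] step[of c s] step[of "Suc c" s] that c this \<delta>(1)
    show "w s c < w s (Suc c) \<and> w s c < w (Suc s) (Suc c) \<and> w (Suc s) c < w s (Suc c) \<and>
        w (Suc s) c < w (Suc s) (Suc c)"
      by (auto simp: abs_less_iff)
  qed
  have point: "point (j, w s)" if "s \<le> N" for s
  proof -
    have "increasing k (w s)"
    proof (rule increasingI)
      show "w s c < w s (Suc c)" if "Suc c < k" for c
        using gap[OF \<open>s \<le> N\<close> that] \<delta>(1) by simp
    qed
    then show ?thesis
      using assms(2) by simp
  qed
  have "below (j, w 0) (j, w s)" if "s \<le> N" for s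
    using that
  proof (induction s)
    case 0
    then show ?case
      using below_refl[OF point] by blast
  next
    case (Suc s)
    have "0 \<le> w (Suc s) i - w s i"
      unfolding diff using assms(5) N_pos by simp
    then have "below (j, w s) (j, w (Suc s))"
      using dictator_separated[OF assms(1,2) sep[OF Suc.prems]] by simp
    then show ?case
      using below_trans[OF point[of 0] point[of s] point[of "Suc s"]] Suc by simp
  qed
  moreover have "w 0 = u" "w N = v"
    using N_pos by (auto simp: w_def)
  ultimately show ?thesis
    by (metis order_refl)
qed

text \<open>Separated \<open>x\<close> and \<open>y\<close> with
  \<open>x i = u i < y i \<le> v i\<close> can be squeezed in: \<open>(j, v)\<close> below
  \<open>(j, u)\<close> would put \<open>(j, y)\<close> below \<open>(j, x)\<close>. The bound
  \<open>1 / 2\<close> keeps \<open>y i\<close> under the next coordinate of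
  \<open>x\<close>.\<close>

lemma dictator_less:
  assumes "dictates i j" "j < t" "increasing k u" "increasing k v" "u i < v i"
  shows "\<not> below (j, v) (j, u)"
proof
  assume vu: "below (j, v) (j, u)"
  define x y where "x = (\<lambda>c. u i + (real c - real i))"
    and "y = (\<lambda>c. if c = i then min (v i) (u i + 1 / 2) else u i + (real c - real i))"
  have sep: "separated k x y"
    using assms(5) by (auto simp: separated_def x_def y_def)
  note incr = separated_increasing[OF sep]
  have "below (j, y) (j, v)" "below (j, u) (j, x)"
    using dictator_le[OF assms(1,2) incr(2) assms(4)] dictator_le[OF assms(1,2,3) incr(1)]
    by (auto simp: x_def y_def)
  then have "below (j, y) (j, x)"
    using vu below_trans[of "(j, y)" "(j, v)" "(j, u)"] below_trans[of "(j, y)" "(j, u)" "(j, x)"]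
      assms(2-4) incr by simp
  moreover have "x i < y i"
    using assms(5) by (simp add: x_def y_def)
  ultimately show False
    using dictator_separated_strict[OF assms(1,2) sep] by blast
qed

text \<open>Only coordinate \<open>i\<close> matters, so \<open>u\<close> may be exchanged for
  \<open>w\<close> with \<open>w i = u i\<close> and \<open>v\<close> for \<open>z\<close> with
  \<open>z i \<ge> v i\<close>. These are chosen to lie as in the standard copy, where blocks
  decide.\<close>

lemma common_dictator:
  assumes "dictates i j" "dictates i j'" "j < j'" "j' < t" "increasing k u" "increasing k v"
  shows "\<not> below (j', u) (j, v)"
proof
  assume uv: "below (j', u) (j, v)"
  define x where "x = max (u i) (v i)"
  define w z where "w = (\<lambda>c. if c \<le> i then u i + (real c - real i) else x + (real c - real i))"
    and "z = (\<lambda>c. if c < i then u i + (real c - real i) else x + (real c - real i))"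
  have x: "u i \<le> x" "v i \<le> x"
    by (simp_all add: x_def)
  have incr: "increasing k w" "increasing k z"
    using x by (auto intro!: increasingI simp: w_def z_def)
  have jt: "j < t"
    using assms(3,4) by simp
  have "below (j', w) (j', u)" "below (j, v) (j, z)"
    using dictator_le[OF assms(2,4) incr(1) assms(5)] dictator_le[OF assms(1) jt assms(6) incr(2)] x
    by (auto simp: w_def z_def)
  then have "below (j', w) (j, z)"
    using uv below_trans[of "(j', w)" "(j', u)" "(j, v)"] below_trans[of "(j', w)" "(j, v)" "(j, z)"]
      assms(4-6) incr jt by simp
  moreover have "below (j', w) (j, z) \<longleftrightarrow> j' \<le> j"
    by (rule below_standard[OF assms(4) jt incr]) (use x in \<open>auto simp: w_def z_def\<close>)
  ultimately show False
    using assms(3) by simp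
qed

text \<open>If all chunks are placed one after another in \<open>k\<close> parts of order type \<open>\<omega>\<close>, then every sample
  with dictator \<open>i\<close> gives rise to one copy of \<open>\<omega>\<close> in the output for each of the \<open>k\<close> parts.\<close>

lemma card_dictated_le:
  assumes J: "J \<subseteq> {..<t}" "\<And>j. j \<in> J \<Longrightarrow> dictates i j"
  shows "card J * k \<le> t"
proof (cases "card J = 0")
  case False
  define a where "a = card J"
  have a: "0 < a * k" "k \<le> a * k"
    using False k_pos by (simp_all add: a_def)
  obtain e where e: "strict_mono_on {..<a} e" "\<And>n. n < a \<Longrightarrow> e n \<in> J"
    using finite_enumerate[of J] J(1) finite_subset a_def by blast
  \<comment> \<open>\<open>Y\<close> is split into \<open>a * k\<close> infinite classes; class
    \<open>p\<close> is used to sample the block \<open>e (p div k)\<close> in the part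
    \<open>p mod k\<close>.\<close>
  define \<nu> where "\<nu> = (\<lambda>p r. enumerate Y (p + a * k * r))"
  \<comment> \<open>For \<open>n\<close> outside \<open>Y\<close> the inverse is an arbitrary
    number, whose remainder still assigns the chunk to some part.\<close>
  define g where "g = (\<lambda>n. inv_into UNIV (enumerate Y) n mod (a * k))"
  have inj: "inj (enumerate Y)"
    using strict_mono_enumerate[OF infinite_Y] strict_mono_imp_inj_on by blast
  have g_\<nu>: "g (\<nu> p r) = p" if "p < a * k" for p r
    using that by (simp add: g_def \<nu>_def inv_f_f[OF inj])
  have \<nu>_Y: "\<nu> p r \<in> Y" for p r
    unfolding \<nu>_def by (rule enumerate_in_set[OF infinite_Y])
  have \<nu>_less: "\<nu> p q < \<nu> p r" if "q < r" for p q r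
    unfolding \<nu>_def using enumerate_mono[OF _ infinite_Y] that a(1) by simp
  \<comment> \<open>The whole chunk \<open>n\<close> goes into one part, where its pieces are lined
    up by \<open>n * k + c\<close>, so later chunks follow earlier ones.\<close>
  define U where "U = (\<lambda>n c. real (g n mod k) + 1 - 1 / (real (n * k + c) + 1))"
  have U_bounds: "real (g n mod k) \<le> U n c" "U n c < real (g n mod k) + 1" for n c
  proof -
    have "0 < 1 / (r + 1)" "1 / (r + 1) \<le> 1" if "0 \<le> r" for r :: real
      using that by simp_all
    from this[of "real (n * k + c)"] show "real (g n mod k) \<le> U n c" "U n c < real (g n mod k) + 1"
      unfolding U_def by linarith+
  qed
  have U_less: "U n c < U m d \<longleftrightarrow> n * k + c < m * k + d" if "g n mod k = g m mod k" for n m c d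
  proof -
    have "U n c < U m d \<longleftrightarrow> 1 / (real (m * k + d) + 1) < 1 / (real (n * k + c) + 1)"
      using that by (simp add: U_def)
    also have "\<dots> \<longleftrightarrow> real (n * k + c) < real (m * k + d)"
      using inverse_less_iff_less[of "real (m * k + d) + 1" "real (n * k + c) + 1"]
      by (simp only: inverse_eq_divide) (simp add: add_nonneg_pos)
    finally show ?thesis
      by (simp only: of_nat_less_iff)
  qed
  have U_incr: "increasing k (U n)" for n
    by (rule increasingI) (simp add: U_less)
  let ?T = "arrangement UNIV U"
  have part_less: "U n c < U m d" if "g n mod k < g m mod k" for n m c d
  proof -
    have "real (g n mod k) + 1 \<le> real (g m mod k)"
      using that by linarith
    then show ?thesis
      using U_bounds(2)[of n c] U_bounds(1)[of m d] by linarith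
  qed
  have T: "?T \<in> copies (omega \<cdot> k)"
  proof (rule copies_times_omegaI[where f = "\<lambda>x. g (idx x) mod k"])
    show "strict_linear ?T"
      by (simp add: arrangement_def strict_linear_keyed)
    show "g (idx x) mod k \<le> g (idx y) mod k" if "lt ?T x y" for x y
      using that part_less[of "idx y" "idx x" "y mod k" "x mod k"]
      by (fastforce simp: arrangement_def lt_keyed not_less[symmetric])
    show "infinite {x \<in> dom ?T. g (idx x) mod k = l}" if "l < k" for l
    proof
      assume "finite {x \<in> dom ?T. g (idx x) mod k = l}"
      then have "finite (idx ` {x. g (idx x) mod k = l})"
        by (simp add: arrangement_def)
      moreover have "range (\<nu> l) \<subseteq> idx ` {x. g (idx x) mod k = l}"
      proof (rule image_subsetI)
        fix r
        obtain x where x: "\<nu> l r = idx x"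
          using surjD[OF idx_surj] by blast
        have "g (\<nu> l r) mod k = l"
          using g_\<nu>[of l r] that a(2) by simp
        then show "\<nu> l r \<in> idx ` {x. g (idx x) mod k = l}"
          using x by auto
      qed
      moreover have "infinite (range (\<nu> l))"
        by (intro range_inj_infinite linorder_injI) (metis \<nu>_less less_irrefl)
      ultimately show False
        using finite_subset by blast
    qed
    show "finite {y \<in> dom ?T. g (idx y) mod k = g (idx x) mod k \<and> lt ?T y x}" for x
    proof (rule finite_subset[of _ "{y. idx y \<in> {..idx x}}"])
      show "{y \<in> dom ?T. g (idx y) mod k = g (idx x) mod k \<and> lt ?T y x} \<subseteq> {y. idx y \<in> {..idx x}}"
      proof
        fix y assume "y \<in> {y \<in> dom ?T. g (idx y) mod k = g (idx x) mod k \<and> lt ?T y x}"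
        then have "\<not> U (idx x) (x mod k) < U (idx y) (y mod k)" "g (idx x) mod k = g (idx y) mod k"
          by (auto simp: arrangement_def lt_keyed)
        then have "idx y * k + y mod k \<le> idx x * k + x mod k"
          using U_less by simp
        moreover have "x mod k < k"
          using k_pos by simp
        ultimately have "idx y * k < Suc (idx x) * k"
          by simp
        then have "idx y < Suc (idx x)"
          by (simp only: mult_less_cancel2)
        then show "y \<in> {y. idx y \<in> {..idx x}}"
          by simp
      qed
    qed (rule finite_idx_vimage, simp)
  qed (use k_pos in simp)
  have good: "good ?T"
    using T by (simp add: good_def)
  have jt: "e (p div k) < t" "dictates i (e (p div k))" if "p < a * k" for p
    using e(2)[of "p div k"] that J less_mult_imp_div_less by auto
  have lt: "lt (G ?T) (b (\<nu> p q) (e (p div k))) (b (\<nu> p' r) (e (p' div k)))"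
    if "p < a * k" "p' < a * k" "\<nu> p q \<noteq> \<nu> p' r"
      "\<not> below (e (p' div k), U (\<nu> p' r)) (e (p div k), U (\<nu> p q))" for p p' q r
  proof -
    have points: "point (e (p div k), U (\<nu> p q))" "point (e (p' div k), U (\<nu> p' r))"
      using jt that(1,2) U_incr by simp_all
    then have "below (e (p div k), U (\<nu> p q)) (e (p' div k), U (\<nu> p' r))"
      using below_total that(4) by blast
    then show ?thesis
      using lt_samples_if_strictly_below[OF good substructure_refl UNIV_I UNIV_I \<nu>_Y \<nu>_Y that(3) points] that(4)
      by blast
  qed
  \<comment> \<open>The chains are stacked by block first and, within a block, by part.\<close>
  have "a * k \<le> t"
  proof (rule chains_le[OF omega[OF T], where s = "\<lambda>p r. b (\<nu> p r) (e (p div k))"])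
    show "b (\<nu> p r) (e (p div k)) \<in> dom (G ?T)" if "p < a * k" for p r
      using sample_dom_arrangement jt that U_incr by simp
    show "lt (G ?T) (b (\<nu> p q) (e (p div k))) (b (\<nu> p r) (e (p div k)))" if "p < a * k" "q < r" for p q r
    proof (rule lt[OF that(1,1)])
      have "U (\<nu> p q) i < U (\<nu> p r) i"
        using U_less[of "\<nu> p q" "\<nu> p r" i i] g_\<nu> that \<nu>_less[OF that(2)] k_pos by simp
      then show "\<not> below (e (p div k), U (\<nu> p r)) (e (p div k), U (\<nu> p q))"
        using dictator_less jt that U_incr by blast
    qed (use \<nu>_less[OF that(2)] in \<open>simp add: less_imp_neq\<close>)
    show "lt (G ?T) (b (\<nu> p q) (e (p div k))) (b (\<nu> p' r) (e (p' div k)))"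
      if p: "p < p'" "p' < a * k" for p p' q r
    proof (rule lt)
      show "p < a * k" using p by simp
      then show "\<nu> p q \<noteq> \<nu> p' r"
        using g_\<nu> p by (metis less_irrefl)
      \<comment> \<open>Within one block the dictator compares the parts; between blocks the common
        dictator leaves the decision to the blocks.\<close>
      show "\<not> below (e (p' div k), U (\<nu> p' r)) (e (p div k), U (\<nu> p q))"
      proof (cases "p div k = p' div k")
        case True
        then have "p mod k < p' mod k"
          using p(1) by (metis div_mult_mod_eq nat_add_left_cancel_less)
        then have "U (\<nu> p q) i < U (\<nu> p' r) i"
          using part_less g_\<nu> \<open>p < a * k\<close> p(2) by simp
        then show ?thesis
          using dictator_less[OF jt(2) jt(1)] p(2) U_incr True by metis
      next
        case False
        then have "p div k < p' div k"
          using p(1) div_le_mono[of p p' k] by simp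
        moreover have "p' div k < a"
          using p(2) less_mult_imp_div_less by blast
        ultimately have "e (p div k) < e (p' div k)"
          using e(1) by (simp add: strict_mono_on_def)
        then show ?thesis
          using common_dictator jt \<open>p < a * k\<close> p(2) U_incr by blast
      qed
    qed (use p in simp)
  qed
  then show ?thesis
    by (simp add: a_def)
qed simp

text \<open>The \<open>t\<close> blocks fall into \<open>k\<close> classes by dictator, each of at
  most \<open>t / k\<close> blocks, so every class attains the bound; \<open>J 0\<close> supplies
  the quotient.\<close>

lemma k_dvd_t: "k dvd t"
proof -
  obtain d where d: "\<And>j. j < t \<Longrightarrow> dictates (d j) j"
    using exists_dictator by metis
  define J where "J = (\<lambda>i. {j. j < t \<and> d j = i})"
  have le: "card (J i) * k \<le> t" for i
    by (rule card_dictated_le[of _ i]) (auto simp: J_def d)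
  have "(\<Sum>i<k. card (J i)) = card (\<Union>i<k. J i)"
    by (rule card_UN_disjoint[symmetric]) (auto simp: J_def)
  also have "(\<Union>i<k. J i) = {..<t}"
    using d by (auto simp: J_def dictates_def)
  finally have sum: "(\<Sum>i<k. card (J i)) = t"
    by simp
  have "card (J 0) * k = t"
  proof (rule ccontr)
    assume "card (J 0) * k \<noteq> t"
    then have "(\<Sum>i<k. card (J i) * k) < (\<Sum>i<k. t)"
      using le k_pos by (intro sum_strict_mono_ex1) (auto intro!: bexI[of _ 0] le_neq_implies_less)
    moreover have "(\<Sum>i<k. card (J i) * k) = t * k"
      unfolding sum[symmetric] by (rule sum_distrib_right[symmetric])
    ultimately show False
      by simp
  qed
  then show ?thesis
    by (metis dvd_triv_right)
qed

end

section \<open>From enumeration operators to divisibility\<close>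

lemma (in sampled_operator) k_dvd_t: "k dvd t"
proof -
  obtain Y A where "infinite Y" "\<forall>n\<in>Y. \<forall>m\<in>Y. n < m \<longrightarrow> colour n m = A"
    using exists_homogeneous by blast
  then interpret homogeneous_operator G k t idx b Y A
    by unfold_locales auto
  show ?thesis
    by (rule k_dvd_t)
qed

lemma (in order_operator) k_dvd_t: "k dvd t"
proof -
  obtain idx b where samples:
    "\<forall>x y. x \<le> y \<longrightarrow> idx x \<le> idx y" "\<forall>n. finite {x. idx x = n}" "surj idx"
    "\<forall>n. \<forall>j<t. b n j \<in> dom (G (restrict_dom standard {x. idx x = n}))"
    "\<forall>n m. \<forall>j<t. \<forall>j'<t. lt (G standard) (b n j) (b m j') \<longleftrightarrow> j < j' \<or> (j = j' \<and> n < (m :: nat))"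
    using exists_samples by (elim exE conjE) (rule that)
  interpret sampled_operator G k t idx b
    by unfold_locales (simp_all add: samples)
  show ?thesis
    by (rule k_dvd_t)
qed

text \<open>Reading off only \<open>Eq b b\<close> and \<open>Less b c\<close> makes sense even when
  the enumerated set is not a diagram, as for finite inputs.\<close>

definition output_structure :: "(basic set \<times> basic) set \<Rightarrow> nat ordstruct \<Rightarrow> nat ordstruct" where
  "output_structure \<Gamma> T = \<lparr>dom = {b. Eq b b \<in> apply_op \<Gamma> T}, lt = (\<lambda>b c. Less b c \<in> apply_op \<Gamma> T)\<rparr>"

lemma apply_op_mono:
  assumes "substructure S T"
  shows "apply_op \<Gamma> S \<subseteq> apply_op \<Gamma> T"
proof -
  have "\<phi> \<in> diagram T" if "\<phi> \<in> diagram S" for \<phi>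
    using that assms by (cases \<phi>) (auto simp: diagram_def substructure_def)
  then show ?thesis
    unfolding apply_op_def by blast
qed

text \<open>The finitely many constants of one premise set \<open>\<alpha>\<close> are all the input
  that a conclusion uses.\<close>

lemma apply_op_compact:
  assumes "enumeration_operator \<Gamma>" "\<phi> \<in> apply_op \<Gamma> T"
  shows "\<exists>X. finite X \<and> X \<subseteq> dom T \<and> \<phi> \<in> apply_op \<Gamma> (restrict_dom T X)"
proof -
  obtain \<alpha> where \<alpha>: "(\<alpha>, \<phi>) \<in> \<Gamma>" "\<alpha> \<subseteq> diagram T"
    using assms(2) unfolding apply_op_def by blast
  let ?X = "\<Union>\<psi>\<in>\<alpha>. constants \<psi>"
  have "finite \<alpha>"
    using assms(1) \<alpha>(1) unfolding enumeration_operator_def by blast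
  moreover have "finite (constants \<psi>)" for \<psi>
    by (cases \<psi>) auto
  ultimately have "finite ?X"
    by blast
  moreover have "?X \<subseteq> dom T"
    using \<alpha>(2) unfolding diagram_def by blast
  moreover have "satisfies (restrict_dom T X) \<psi> \<longleftrightarrow> satisfies T \<psi>" for X \<psi>
    by (cases \<psi>) (auto simp: restrict_dom_def)
  then have "\<alpha> \<subseteq> diagram (restrict_dom T ?X)"
    using \<alpha>(2) unfolding diagram_def by (auto simp: restrict_dom_def)
  then have "\<phi> \<in> apply_op \<Gamma> (restrict_dom T ?X)"
    using \<alpha>(1) unfolding apply_op_def by blast
  ultimately show ?thesis
    by blast
qed

lemma output_structure_copies:
  assumes "T' \<in> copies A" "apply_op \<Gamma> T = diagram T'"
  shows "output_structure \<Gamma> T \<in> copies A"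
proof (rule copies_closed[OF assms(1)])
  show "T' \<cong> output_structure \<Gamma> T"
    unfolding isomorphic_def
    by (intro exI[of _ id]) (auto simp: output_structure_def assms(2) diagram_def)
qed

lemma dvd_if_pair_le_c:
  assumes "k \<noteq> 0"
    and "pair_le_c (omega \<cdot> k) (omega_star \<cdot> k) (omega \<cdot> t) (omega_star \<cdot> t)"
  shows "k dvd t"
proof -
  obtain \<Gamma> where \<Gamma>: "enumeration_operator \<Gamma>"
    "\<forall>S\<in>copies (omega \<cdot> k). \<exists>T\<in>copies (omega \<cdot> t). apply_op \<Gamma> S = diagram T"
    "\<forall>S\<in>copies (omega_star \<cdot> k). \<exists>T\<in>copies (omega_star \<cdot> t). apply_op \<Gamma> S = diagram T"
    using assms(2) unfolding pair_le_c_def computable_embedding_def by blast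
  interpret order_operator "output_structure \<Gamma>" k t
  proof unfold_locales
    show "0 < k"
      using assms(1) by simp
    fix S T :: "nat ordstruct" assume sub: "substructure S T"
    show "dom (output_structure \<Gamma> S) \<subseteq> dom (output_structure \<Gamma> T)"
      "\<And>b c. lt (output_structure \<Gamma> S) b c \<Longrightarrow> lt (output_structure \<Gamma> T) b c"
      using apply_op_mono[OF sub, of \<Gamma>] by (auto simp: output_structure_def)
  next
    fix T :: "nat ordstruct" and b assume "b \<in> dom (output_structure \<Gamma> T)"
    then show "\<exists>X. finite X \<and> X \<subseteq> dom T \<and> b \<in> dom (output_structure \<Gamma> (restrict_dom T X))"
      using apply_op_compact[OF \<Gamma>(1)] by (simp add: output_structure_def)
  next
    fix T :: "nat ordstruct" and b c assume "lt (output_structure \<Gamma> T) b c"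
    then show "\<exists>X. finite X \<and> X \<subseteq> dom T \<and> lt (output_structure \<Gamma> (restrict_dom T X)) b c"
      using apply_op_compact[OF \<Gamma>(1)] by (simp add: output_structure_def)
  next
    fix T assume "T \<in> copies (omega \<cdot> k)"
    then show "output_structure \<Gamma> T \<in> copies (omega \<cdot> t)"
      using \<Gamma>(2) output_structure_copies by blast
  next
    fix T assume "T \<in> copies (omega_star \<cdot> k)"
    then show "output_structure \<Gamma> T \<in> copies (omega_star \<cdot> t)"
      using \<Gamma>(3) output_structure_copies by blast
  qed
  show ?thesis
    by (rule k_dvd_t)
qed

theorem theorem5p12:
  fixes k t :: nat
  assumes "k \<noteq> 0" and "t \<noteq> 0"
  shows "k dvd t \<longleftrightarrow>
    pair_le_c (omega \<cdot> k) (omega_star \<cdot> k) (omega \<cdot> t) (omega_star \<cdot> t)"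
  using pair_le_c_if_dvd[OF assms] dvd_if_pair_le_c[OF assms(1)] by blast

end
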